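(* Let $c>0$, let $\ell_n=c\,\frac{\ln n}{n}$, let $\{\omega_n\}_{n\in\mathbb{N}}$ be an i.i.d. sequence uniformly distributed on $\mathbb{T}=\mathbb{R}/\mathbb{Z}$, let $\mathcal{U}(\omega)$ be the associated uniform random covering set (defined in the context), and let $A\subset\mathbb{T}$ be a set. If $c>\overline{\dim}_{\mathrm B}A+1$, then there is a uniform random covering of $A$, i.e. $\Pr(\omega\colon A\subset\mathcal{U}(\omega))=1$. If $c<\dim_{\mathrm H}A$, then there is no covering, i.e. $\Pr(\omega\colon A\subset\mathcal{U}(\omega))=0$.
   Context: Put $r_n=\ell_n/2$ and, for $x\in\mathbb{T}$, let $B(x,r)=(x-r,x+r)\subset\mathbb{T}$ be the open arc of center $x$ and radius $r$. For each $n\in\mathbb{N}$ let $E_n=\bigcup_{k=1}^{n}B(\omega_k,r_n)$, and define $\mathcal{U}(\omega)=\liminf_{n\to\infty}E_n=\bigcup_{N\ge1}\bigcap_{n\ge N}E_n$. (Only the values of $\ell_n$ for large $n$ matter for $\mathcal{U}(\omega)$.) $\dim_{\mathrm H}$ and $\overline{\dim}_{\mathrm B}$ denote the Hausdorff dimension and the upper box-counting dimension, respectively.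
   Formalization: In the no-covering half, Pr(A ⊂ U)=0 is stated as such for Borel A; for arbitrary A, where the event can be non-measurable (under CH), it says every measurable set of sequences for which A ⊂ U has probability 0, which gives Pr=0 whenever the event is measurable for the law of the sequence. *)

theory Defs
  imports "HOL-Probability.Probability"
begin

section \<open>The circle \<open>\<real>/\<int>\<close>\<close>

lemma infdist_Ints_le:
  fixes x y :: real
  assumes "x - y \<in> \<int>"
  shows "infdist x \<int> \<le> infdist y \<int>"
proof -
  have "closed (\<int> :: real set)" "(\<int> :: real set) \<noteq> {}"
    using Ints_0 by auto
  then obtain m where m: "m \<in> \<int>" "infdist y \<int> = dist y m"
    using infdist_attains_inf by blast
  have "m + (x - y) \<in> \<int>"
    using m assms by (intro Ints_add)
  from infdist_le[OF this, of x] show ?thesis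
    using m by (simp add: dist_real_def)
qed

lemma infdist_Ints_uminus: "infdist (- x) \<int> = infdist (x::real) \<int>"
proof -
  have *: "infdist (- x) \<int> \<le> infdist x \<int>" for x :: real
  proof -
    have "closed (\<int> :: real set)" "(\<int> :: real set) \<noteq> {}"
      using Ints_0 by auto
    then obtain m where m: "m \<in> \<int>" "infdist x \<int> = dist x m"
      using infdist_attains_inf by blast
    have "- m \<in> \<int>"
      using m by simp
    from infdist_le[OF this, of "- x"] show ?thesis
      using m by (simp add: dist_real_def)
  qed
  from *[of x] *[of "- x"] show ?thesis by simp
qed

lemma infdist_Ints_add: "infdist (x + y) \<int> \<le> infdist x \<int> + infdist (y::real) \<int>"
proof -
  have "closed (\<int> :: real set)" "(\<int> :: real set) \<noteq> {}"
    using Ints_0 by auto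
  then obtain m n where m: "m \<in> \<int>" "infdist x \<int> = dist x m"
    and n: "n \<in> \<int>" "infdist y \<int> = dist y n"
    using infdist_attains_inf by metis
  have "m + n \<in> \<int>"
    using m n by (intro Ints_add)
  from infdist_le[OF this, of "x + y"] show ?thesis
    using m n by (simp add: dist_real_def)
qed

lemma infdist_Ints_cong:
  fixes x y :: real
  assumes "x - y \<in> \<int>"
  shows "infdist x \<int> = infdist y \<int>"
proof -
  have "y - x \<in> \<int>"
    using Ints_minus[OF assms] by simp
  with assms show ?thesis
    by (intro antisym infdist_Ints_le)
qed

quotient_type circle = real / "\<lambda>x y. x - y \<in> \<int>"
  morphisms rep_circle to_circle
proof (rule equivpI)
  show "reflp (\<lambda>x y::real. x - y \<in> \<int>)"
    by (simp add: reflp_def)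
  show "symp (\<lambda>x y::real. x - y \<in> \<int>)"
    using Ints_minus by (fastforce intro: sympI)
  show "transp (\<lambda>x y::real. x - y \<in> \<int>)"
  proof (rule transpI)
    fix x y z :: real
    assume "x - y \<in> \<int>" "y - z \<in> \<int>"
    then have "(x - y) + (y - z) \<in> \<int>"
      by (rule Ints_add)
    then show "x - z \<in> \<int>"
      by simp
  qed
qed

instantiation circle :: metric_space
begin

lift_definition dist_circle :: "circle \<Rightarrow> circle \<Rightarrow> real" is "\<lambda>x y. infdist (x - y) \<int>"
proof (rule infdist_Ints_cong)
  fix x x' y y' :: real
  assume "x - x' \<in> \<int>" "y - y' \<in> \<int>"
  then have "(x - x') - (y - y') \<in> \<int>"
    by (rule Ints_diff)
  then show "x - y - (x' - y') \<in> \<int>"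
    by (simp add: algebra_simps)
qed

definition uniformity_circle :: "(circle \<times> circle) filter" where
  "uniformity_circle = (INF e\<in>{0<..}. principal {(x, y). dist x y < e})"

definition open_circle :: "circle set \<Rightarrow> bool" where
  "open_circle U \<longleftrightarrow> (\<forall>x\<in>U. \<forall>\<^sub>F (x', y) in uniformity. x' = x \<longrightarrow> y \<in> U)"

instance
proof
  fix x y z :: circle
  show "(dist x y = 0) = (x = y)"
  proof transfer
    fix x y :: real
    have "closed (\<int> :: real set)" "(\<int> :: real set) \<noteq> {}"
      using Ints_0 by auto
    then show "(infdist (x - y) \<int> = 0) = (x - y \<in> \<int>)"
      using in_closed_iff_infdist_zero by blast
  qed
  show "dist x y \<le> dist x z + dist y z"
  proof transfer
    fix x y z :: real
    show "infdist (x - y) \<int> \<le> infdist (x - z) \<int> + infdist (y - z) \<int>"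
      using infdist_Ints_add[of "x - z" "z - y"] infdist_Ints_uminus[of "y - z"] by simp
  qed
qed (fact uniformity_circle_def open_circle_def)+

end

lemma dist_to_circle: "dist (to_circle x) (to_circle y) = infdist (x - y) \<int>"
  by transfer simp

lemma dist_to_circle_le: "dist (to_circle x) (to_circle y) \<le> \<bar>x - y\<bar>"
  unfolding dist_to_circle using infdist_le[of 0 "\<int>" "x - y"] by simp

lemma to_circle_eq_iff: "to_circle x = to_circle y \<longleftrightarrow> x - y \<in> \<int>"
  by transfer simp

lemma ball_to_circle: "ball (to_circle x) r = to_circle ` {x - r<..<x + r}"
proof (intro equalityI subsetI)
  fix z assume z: "z \<in> ball (to_circle x) r"
  obtain y where y: "z = to_circle y"
    by (metis Quotient3_abs_rep Quotient3_circle)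
  have "closed (\<int> :: real set)" "(\<int> :: real set) \<noteq> {}"
    using Ints_0 by auto
  then obtain m where m: "m \<in> \<int>" "infdist (x - y) \<int> = dist (x - y) m"
    using infdist_attains_inf by blast
  have "\<bar>x - (y + m)\<bar> < r"
    using z m by (simp add: y dist_to_circle dist_real_def algebra_simps)
  then have "y + m \<in> {x - r<..<x + r}"
    by auto
  moreover have "z = to_circle (y + m)"
    using m by (simp add: y to_circle_eq_iff)
  ultimately show "z \<in> to_circle ` {x - r<..<x + r}"
    by blast
next
  fix z assume "z \<in> to_circle ` {x - r<..<x + r}"
  then obtain y where "z = to_circle y" "\<bar>x - y\<bar> < r"
    by (auto simp: abs_less_iff)
  then show "z \<in> ball (to_circle x) r"
    using dist_to_circle_le[of x y] by simp
qed

lemma continuous_on_to_circle: "continuous_on S to_circle"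
  unfolding continuous_on_iff
  by (metis dist_to_circle_le dist_real_def order_le_less_trans)

lemma measurable_to_circle [measurable]: "to_circle \<in> borel_measurable borel"
  by (intro borel_measurable_continuous_onI continuous_on_to_circle)

definition uniform_circle :: "circle measure" where
  "uniform_circle = distr (uniform_measure lborel {0..<1}) borel to_circle"


section \<open>Hausdorff dimension\<close>

text \<open>The case distinction fixes \<open>\<bar>{}\<bar>\<^sup>s = 0\<close> and \<open>\<bar>U\<bar>\<^sup>0 = 1\<close> for nonempty \<open>U\<close>; in contrast,
  \<^term>\<open>0 powr 0 = (0::real)\<close>.\<close>

definition diam_power :: "real \<Rightarrow> 'a::metric_space set \<Rightarrow> ennreal" where
  "diam_power s U =
     (if U = {} then 0 else if s = 0 then 1 else ennreal (diameter U powr s))"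

text \<open>Boundedness is required because \<^const>\<open>diameter\<close> is unspecified on unbounded sets.\<close>

definition hausdorff_premeasure :: "real \<Rightarrow> real \<Rightarrow> 'a::metric_space set \<Rightarrow> ennreal" where
  "hausdorff_premeasure s \<delta> A =
     (INF U \<in> {U :: nat \<Rightarrow> 'a set. A \<subseteq> (\<Union>i. U i) \<and> (\<forall>i. bounded (U i) \<and> diameter (U i) \<le> \<delta>)}.
        \<Sum>i. diam_power s (U i))"

definition hausdorff_measure :: "real \<Rightarrow> 'a::metric_space set \<Rightarrow> ennreal" where
  "hausdorff_measure s A = (SUP \<delta> \<in> {0<..}. hausdorff_premeasure s \<delta> A)"

definition hausdorff_dim :: "'a::metric_space set \<Rightarrow> ereal" where
  "hausdorff_dim A = (INF s \<in> {s. 0 \<le> s \<and> hausdorff_measure s A = 0}. ereal s)"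


section \<open>Upper box-counting dimension\<close>

definition covering_number :: "real \<Rightarrow> circle set \<Rightarrow> nat" where
  "covering_number \<delta> A =
     (LEAST n. \<exists>F. finite F \<and> card F = n \<and> A \<subseteq> \<Union>F \<and> (\<forall>U\<in>F. diameter U \<le> \<delta>))"

text \<open>Finite covers exist for every positive \<open>\<delta>\<close>, so the minimum above is attained.\<close>

lemma finite_cover_circle:
  assumes "\<delta> > 0"
  shows "\<exists>F. finite F \<and> (A :: circle set) \<subseteq> \<Union>F \<and> (\<forall>U\<in>F. diameter U \<le> \<delta>)"
proof -
  obtain n :: nat where n: "inverse (real (Suc n)) < \<delta>"
    using reals_Archimedean[OF assms] by blast
  define I where "I k = {real k / Suc n..real (Suc k) / Suc n}" for k
  have "x \<in> \<Union>((\<lambda>k. to_circle ` I k) ` {..n})" for x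
  proof -
    obtain y where y: "x = to_circle y"
      by (metis Quotient3_abs_rep Quotient3_circle)
    define k where "k = nat \<lfloor>frac y * Suc n\<rfloor>"
    have nn: "0 \<le> frac y * Suc n" by simp
    have k: "real k \<le> frac y * Suc n" "frac y * Suc n < real k + 1"
      using nn unfolding k_def by auto
    have "frac y * real (Suc n) < 1 * real (Suc n)"
      by (intro mult_strict_right_mono frac_lt_1) simp
    with k(1) have "real k < real (Suc n)"
      by (simp only: mult_1_left order_le_less_trans)
    then have "k \<le> n"
      by (simp only: of_nat_less_iff less_Suc_eq_le)
    moreover have "frac y \<in> I k"
      using k by (auto simp: I_def field_simps)
    moreover have "x = to_circle (frac y)"
      by (simp add: y to_circle_eq_iff frac_def)
    ultimately show ?thesis by blast
  qed
  moreover have "diameter (to_circle ` I k) \<le> \<delta>" for k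
  proof -
    have "dist x y \<le> \<delta>" if xy: "x \<in> to_circle ` I k" "y \<in> to_circle ` I k" for x y
    proof -
      obtain u v where uv: "x = to_circle u" "y = to_circle v" "u \<in> I k" "v \<in> I k"
        using xy by blast
      have "real (Suc k) / Suc n = real k / Suc n + inverse (real (Suc n))"
        by (simp add: field_simps)
      with uv have "\<bar>u - v\<bar> \<le> inverse (real (Suc n))"
        unfolding I_def by (simp only: atLeastAtMost_iff) linarith
      then show ?thesis
        unfolding uv(1,2) using dist_to_circle_le[of u v] n by linarith
    qed
    then show ?thesis
      using assms by (auto simp: diameter_def intro!: cSUP_least)
  qed
  ultimately show ?thesis
    by (intro exI[of _ "(\<lambda>k. to_circle ` I k) ` {..n}"]) auto
qed

text \<open>Since \<^term>\<open>ln 0 = (0::real)\<close>, the empty set has dimension \<open>0\<close>.\<close>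

definition upper_box_dim :: "circle set \<Rightarrow> ereal" where
  "upper_box_dim A =
     Limsup (at_right 0) (\<lambda>\<delta>. ereal (ln (real (covering_number \<delta> A)) / - ln \<delta>))"


section \<open>Uniform covering\<close>

definition covered_upto :: "(nat \<Rightarrow> real) \<Rightarrow> (nat \<Rightarrow> circle) \<Rightarrow> nat \<Rightarrow> circle set" where
  "covered_upto l w n = (\<Union>k\<in>{1..n}. ball (w k) (l n / 2))"

definition uniform_covering_set :: "(nat \<Rightarrow> real) \<Rightarrow> (nat \<Rightarrow> circle) \<Rightarrow> circle set" where
  "uniform_covering_set l w = (\<Union>N\<in>{1..}. \<Inter>n\<in>{N..}. covered_upto l w n)"

end

theory Submission
  imports Defs "HOL-Real_Asymp.Real_Asymp"
begin

text \<open>Covering: for \<open>d < c - 1\<close> above the box dimension, \<open>A\<close> is covered by \<open>n powr d\<close> balls of radius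
  \<open>1/n\<close>, and the center of such a ball has distance at least \<open>l n / 2 - 1 / n\<close> to the first \<open>n\<close> points
  with probability at most \<open>exp 2 * n powr (- c)\<close>. Borel--Cantelli applies.

  No covering: let \<open>E\<close> be a set of sequences of positive probability that all cover \<open>A\<close>. After shrinking \<open>E\<close>
  to a closed set that charges each of its nonempty relatively open parts, the Baire category theorem in \<open>E\<close>
  splits \<open>A\<close> into countably many sets \<open>P\<close>, each of which lies, on an event of positive probability, in the
  union of the first \<open>n\<close> closed arcs of radius \<open>l n / 2\<close> for all large \<open>n\<close> simultaneously. If \<open>P\<close> had positive \<open>s\<close>-dimensional measure
  for some \<open>s > c\<close>, it would contain about \<open>(l n) powr (- s)\<close> points at distance more than \<open>l n\<close> from each
  other. Each remains uncovered with probability about \<open>n powr (- c)\<close>, so that the second moment method yields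
  an uncovered one with probability tending to 1. No Frostman measure is needed, since only one scale matters.

  If \<open>A\<close> is Borel, the sequences that do not cover \<open>A\<close> form an analytic set. It is measurable up to null sets,
  so the previous paragraph shows that it has full measure.\<close>

section \<open>The uniform distribution on the circle\<close>

lemma to_circle_surj: obtains a where "z = to_circle a" "0 \<le> a" "a < 1"
proof -
  obtain y where y: "z = to_circle y"
    by (metis Quotient3_abs_rep Quotient3_circle)
  have "z = to_circle (frac y)"
    by (simp add: y to_circle_eq_iff frac_def)
  with that show ?thesis by (simp add: frac_lt_1)
qed

lemma compact_circle: "compact (UNIV :: circle set)"
proof -
  have "to_circle ` {0..1} = UNIV"
  proof (intro UNIV_eq_I[symmetric])
    fix z obtain a where "z = to_circle a" "0 \<le> a" "a < 1" by (rule to_circle_surj)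
    then show "z \<in> to_circle ` {0..1}" by auto
  qed
  then show ?thesis
    using compact_continuous_image[OF continuous_on_to_circle[of "{0..1}"]] by simp
qed

lemma bounded_circle [simp]: "bounded (U :: circle set)"
  by (rule bounded_subset[OF compact_imp_bounded[OF compact_circle]]) simp

text \<open>Completeness and second countability make the circle, and with it the space of sequences
  in it, a Polish space. Inner regularity and the Baire category theorem are applied to such
  sequences.\<close>

instance circle :: complete_space
proof
  fix X :: "nat \<Rightarrow> circle" assume "Cauchy X"
  then show "convergent X"
    using compact_imp_complete[OF compact_circle] unfolding complete_def convergent_def by blast
qed

instance circle :: second_countable_topology
proof
  define B where "B = (\<lambda>(a, b). to_circle ` {real_of_rat a<..<real_of_rat b}) ` UNIV"
  have op: "open (to_circle ` {a<..<b})" for a b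
    using open_ball[of "to_circle ((a + b) / 2)" "(b - a) / 2"]
    unfolding ball_to_circle by (simp add: field_simps)
  have "topological_basis B"
  proof (rule topological_basisI)
    show "open U" if "U \<in> B" for U
      using that op by (auto simp: B_def)
  next
    fix U z assume "open U" "(z::circle) \<in> U"
    then obtain r where r: "r > 0" "ball z r \<subseteq> U"
      using openE by blast
    obtain x where x: "z = to_circle x" by (rule to_circle_surj)
    obtain a where a: "x - r < of_rat a" "of_rat a < x"
      using of_rat_dense[of "x - r" x] r(1) by auto
    obtain b where b: "x < of_rat b" "of_rat b < x + r"
      using of_rat_dense[of x "x + r"] r(1) by auto
    note ab = a b
    have "to_circle ` {real_of_rat a<..<real_of_rat b} \<subseteq> U"
      using r(2) ab unfolding x ball_to_circle by force
    moreover have "z \<in> to_circle ` {real_of_rat a<..<real_of_rat b}"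
      using ab by (auto simp: x)
    ultimately show "\<exists>V\<in>B. z \<in> V \<and> V \<subseteq> U"
      unfolding B_def by blast
  qed
  moreover have "countable B"
    by (simp add: B_def)
  ultimately show "\<exists>B :: circle set set. countable B \<and> open = generate_topology B"
    by (intro exI[of _ B]) (simp add: topological_basis_imp_subbasis)
qed

instance circle :: polish_space ..

section \<open>Probability of arcs\<close>

lemma prob_space_uniform_circle: "prob_space uniform_circle"
proof -
  interpret prob_space "uniform_measure lborel {0..<1::real}"
    by (rule prob_space_uniform_measure) auto
  show ?thesis
    unfolding uniform_circle_def by (rule prob_space_distr) simp
qed

lemma sets_uniform_circle [simp, measurable_cong]: "sets uniform_circle = sets borel"
  by (simp add: uniform_circle_def)

lemma space_uniform_circle [simp]: "space uniform_circle = UNIV"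
  by (simp add: uniform_circle_def)

lemma measure_uniform_circle:
  assumes "S \<in> sets borel"
  shows "measure uniform_circle S = measure lborel ({0..<1} \<inter> to_circle -` S)"
proof -
  have [measurable]: "to_circle -` S \<in> sets borel"
    using measurable_sets[OF measurable_to_circle assms] by simp
  show ?thesis
    unfolding uniform_circle_def
    using assms by (simp add: measure_distr measure_uniform_measure)
qed

text \<open>In the fundamental domain [0,1) the arc contains one interval, or two if it passes
  through the image of 0, of total length \<open>2 * r\<close>.\<close>

lemma measure_uniform_circle_ball_ge:
  assumes r: "0 \<le> r" "r \<le> 1/2"
  shows "2 * r \<le> measure uniform_circle (ball z r)"
proof -
  obtain a where a: "z = to_circle a" "0 \<le> a" "a < 1" by (rule to_circle_surj)
  let ?B = "{0..<1} \<inter> to_circle -` ball z r"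
  have B [measurable]: "?B \<in> sets borel"
    using measurable_sets[OF measurable_to_circle, of "ball z r"] by simp
  have "emeasure lborel ?B \<le> emeasure lborel {0..<1::real}"
    by (intro emeasure_mono) auto
  then have B_fin: "?B \<in> fmeasurable lborel"
    by (auto simp: fmeasurable_def le_less_trans)
  \<comment> \<open>The integers \<open>k\<close> and \<open>k'\<close> shift the lift
    \<open>a\<close> of the center next to either interval. An arc with a single interval is treated
    with \<open>p' = q'\<close>.\<close>
  have two: "2 * r \<le> measure uniform_circle (ball z r)"
    if pq: "p \<le> q" "q \<le> p'" "p' \<le> q'" "(q - p) + (q' - p') = 2 * r" and k: "k \<in> \<int>" "k' \<in> \<int>"
      and 1: "\<And>t. p < t \<Longrightarrow> t < q \<Longrightarrow> 0 \<le> t \<and> t < 1 \<and> \<bar>a + k - t\<bar> < r"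
      and 2: "\<And>t. p' < t \<Longrightarrow> t < q' \<Longrightarrow> 0 \<le> t \<and> t < 1 \<and> \<bar>a + k' - t\<bar> < r"
    for p q p' q' k k'
  proof -
    have z: "z = to_circle (a + k)" "z = to_circle (a + k')"
      using k by (simp_all add: a to_circle_eq_iff)
    have d: "dist z (to_circle t) \<le> \<bar>a + k - t\<bar>" "dist z (to_circle t) \<le> \<bar>a + k' - t\<bar>" for t
      using dist_to_circle_le[of "a + k" t] dist_to_circle_le[of "a + k'" t] z by simp_all
    have sub: "{p<..<q} \<union> {p'<..<q'} \<subseteq> ?B"
    proof
      fix t assume "t \<in> {p<..<q} \<union> {p'<..<q'}"
      then consider "p < t" "t < q" | "p' < t" "t < q'" by auto
      then show "t \<in> ?B"
      proof cases
        case 1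
        then show ?thesis using that(7)[of t] d(1)[of t] by simp
      next
        case 2
        then show ?thesis using that(8)[of t] d(2)[of t] by simp
      qed
    qed
    have "measure lborel ({p<..<q} \<union> {p'<..<q'}) = measure lborel {p<..<q} + measure lborel {p'<..<q'}"
      using pq by (intro measure_Union) auto
    then have "2 * r = measure lborel ({p<..<q} \<union> {p'<..<q'})"
      using pq by simp
    also have "\<dots> \<le> measure lborel ?B"
      using sub B_fin by (intro measure_mono_fmeasurable) auto
    finally show ?thesis
      by (simp add: measure_uniform_circle)
  qed
  consider "a < r" | "a + r > 1" | "a \<ge> r" "a + r \<le> 1" by linarith
  then show ?thesis
  proof cases
    case 1
    then show ?thesis
      using a(2,3) r by - (rule two[of 0 "a + r" "a + 1 - r" 1 0 1]; simp add: abs_less_iff)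
  next
    case 2
    then show ?thesis
      using a(2,3) r by - (rule two[of 0 "a + r - 1" "a - r" 1 "-1" 0]; simp add: abs_less_iff)
  next
    case 3
    then show ?thesis
      using a(2,3) r by - (rule two[of "a - r" "a + r" "a + r" "a + r" 0 0]; simp add: abs_less_iff)
  qed
qed

text \<open>The open ball of radius \<open>1/2 - r\<close> around the antipode is disjoint from this
  closed ball, so the lower bound for the former is an upper bound for the latter.\<close>

lemma measure_uniform_circle_cball_le:
  assumes r: "0 \<le> r" "r \<le> 1/2"
  shows "measure uniform_circle (cball z r) \<le> 2 * r"
proof -
  interpret prob_space uniform_circle by (rule prob_space_uniform_circle)
  obtain a where a: "z = to_circle a" by (rule to_circle_surj)
  define z' where "z' = to_circle (a + 1/2)"
  have disj: "cball z r \<inter> ball z' (1/2 - r) = {}"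
  proof -
    have "dist z z' \<ge> 1/2"
    proof -
      have "infdist (-1/2) (\<int>::real set) \<ge> 1/2"
      proof -
        obtain m :: real where m: "m \<in> \<int>" "infdist (-1/2::real) \<int> = dist (-1/2) m"
          using infdist_attains_inf[OF closed_Ints, of "-1/2::real"] Ints_0 by (metis empty_iff)
        obtain k where k: "m = of_int k" using m(1) by (rule Ints_cases)
        have "k \<le> -1 \<or> k \<ge> 0" by linarith
        then have "m \<le> -1 \<or> m \<ge> 0" unfolding k by linarith
        then show ?thesis unfolding m(2) dist_real_def by linarith
      qed
      then show ?thesis by (simp add: a z'_def dist_to_circle)
    qed
    show ?thesis
    proof (rule ccontr)
      assume "\<not> ?thesis"
      then obtain y where "dist z y \<le> r" "dist z' y < 1/2 - r" by auto
      then show False using \<open>dist z z' \<ge> 1/2\<close> dist_triangle2[of z z' y] by linarith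
    qed
  qed
  have "1 - 2 * r \<le> prob (ball z' (1/2 - r))"
    using measure_uniform_circle_ball_ge[of "1/2 - r" z'] r by simp
  moreover have "prob (cball z r) + prob (ball z' (1/2 - r)) = prob (cball z r \<union> ball z' (1/2 - r))"
    using disj by (intro finite_measure_Union[symmetric]) auto
  moreover have "\<dots> \<le> 1" by simp
  ultimately show ?thesis by linarith
qed

section \<open>Independent uniform points\<close>

locale iid_uniform = prob_space +
  fixes X :: "nat \<Rightarrow> 'a \<Rightarrow> circle"
  assumes indep: "indep_vars (\<lambda>_. borel) X {1..}"
    and uniform: "k \<ge> 1 \<Longrightarrow> distr M borel (X k) = uniform_circle"
begin

lemma measurable_X: "k \<ge> 1 \<Longrightarrow> X k \<in> borel_measurable M"
  using indep unfolding indep_vars_def by auto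

lemma sets_forall_X [measurable]:
  assumes "B \<in> sets borel"
  shows "{x \<in> space M. \<forall>k\<in>{1..n}. X k x \<in> B} \<in> sets M"
proof -
  have "{x \<in> space M. X k x \<in> B} \<in> sets M" if "k \<in> {1..n}" for k
    using measurable_sets[OF measurable_X assms, of k] that by (simp add: vimage_def Int_def conj_commute)
  then show ?thesis by (intro sets.sets_Collect_finite_All) auto
qed

lemma prob_forall_X:
  assumes B: "B \<in> sets borel"
  shows "prob {x \<in> space M. \<forall>k\<in>{1..n}. X k x \<in> B} = measure uniform_circle B ^ n"
\<comment> \<open>For \<open>n = 0\<close> the intersection of the preimages would be
  \<open>UNIV\<close> instead of \<open>space M\<close>.\<close>
proof (cases "n = 0")
  case True
  then show ?thesis by (simp add: prob_space)
next
  case False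
  have "{x \<in> space M. \<forall>k\<in>{1..n}. X k x \<in> B} = (\<Inter>k\<in>{1..n}. X k -` B \<inter> space M)"
    using False by auto
  also have "prob \<dots> = (\<Prod>k\<in>{1..n}. prob (X k -` B \<inter> space M))"
    using False B by (intro indep_varsD[OF indep]) auto
  also have "\<dots> = (\<Prod>k\<in>{1..n}. measure uniform_circle B)"
  proof (intro prod.cong refl)
    fix k assume "k \<in> {1..n}"
    then show "prob (X k -` B \<inter> space M) = measure uniform_circle B"
      using measure_distr[OF measurable_X B, of k] uniform[of k] by simp
  qed
  finally show ?thesis by simp
qed

end

section \<open>Covering above the box dimension\<close>

text \<open>A set of diameter at most \<open>1 / n\<close> lies in the closed ball of that radius
  around any of its points. The bound on the upper limit is read off at the scales
  \<open>1 / n\<close>, which tend to 0 from the right.\<close>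

lemma upper_box_dim_less_imp_cover:
  assumes "upper_box_dim A < ereal d"
  shows "\<forall>\<^sub>F n in sequentially. \<exists>F. finite F \<and> real (card F) \<le> real n powr d \<and>
           A \<subseteq> (\<Union>x\<in>F. cball x (1 / real n))"
proof -
  have "\<forall>\<^sub>F \<delta> in at_right 0. ln (real (covering_number \<delta> A)) / - ln \<delta> < d"
    using Limsup_lessD[OF assms[unfolded upper_box_dim_def]] by simp
  moreover have "filterlim (\<lambda>n. 1 / real n) (at_right 0) sequentially"
    by real_asymp
  ultimately have "\<forall>\<^sub>F n in sequentially. ln (real (covering_number (1 / real n) A)) / - ln (1 / real n) < d"
    unfolding filterlim_iff by blast
  then show ?thesis
    using eventually_gt_at_top[of 1]
  proof eventually_elim
    case (elim n)
    let ?N = "covering_number (1 / real n) A"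
    have "\<exists>m F. finite F \<and> card F = m \<and> A \<subseteq> \<Union>F \<and> (\<forall>U\<in>F. diameter U \<le> 1 / real n)"
      using finite_cover_circle[of "1 / real n" A] elim by auto
    then have "\<exists>F. finite F \<and> card F = ?N \<and> A \<subseteq> \<Union>F \<and> (\<forall>U\<in>F. diameter U \<le> 1 / real n)"
      unfolding covering_number_def by (rule LeastI_ex)
    then obtain F where F: "finite F" "card F = ?N" "A \<subseteq> \<Union>F" "\<And>U. U \<in> F \<Longrightarrow> diameter U \<le> 1 / real n"
      by blast
    have "real ?N \<le> real n powr d"
    proof (cases "?N = 0")
      case False
      have "ln (real ?N) < d * ln (real n)"
        using elim by (simp add: ln_div field_simps)
      also have "\<dots> = ln (real n powr d)"
        using elim by (simp add: ln_powr)
      finally show ?thesis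
        using False elim(2) by (subst (asm) ln_less_cancel_iff) auto
    qed simp
    \<comment> \<open>An empty \<open>U\<close> contributes an arbitrary point, which does no harm:
      the union only grows, and the number of points stays at most \<open>card F\<close>.\<close>
    moreover define p where "p U = (SOME x. x \<in> U)" for U :: "circle set"
    have "A \<subseteq> (\<Union>x\<in>p ` F. cball x (1 / real n))"
    proof
      fix x assume "x \<in> A"
      then obtain U where U: "U \<in> F" "x \<in> U" using F(3) by auto
      have "p U \<in> U" unfolding p_def using U(2) by (rule someI)
      then have "dist (p U) x \<le> diameter U"
        using U(2) by (intro diameter_bounded_bound) auto
      with F(4)[OF U(1)] U(1) show "x \<in> (\<Union>x\<in>p ` F. cball x (1 / real n))" by force
    qed
    moreover have "card (p ` F) \<le> ?N"
      using card_image_le[OF F(1), of p] F(2) by simp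
    ultimately show ?case
      using F(1) by (intro exI[of _ "p ` F"]) (auto intro: order_trans)
  qed
qed

lemma (in iid_uniform) AE_uniform_covering:
  assumes c: "c > 0" and l: "\<And>n. n \<ge> 1 \<Longrightarrow> l n = c * (ln (real n) / real n)"
    and dim: "upper_box_dim A + 1 < ereal c"
  shows "AE x in M. A \<subseteq> uniform_covering_set l (\<lambda>k. X k x)"
proof -
  have "upper_box_dim A < ereal (c - 1)"
    using dim by (cases "upper_box_dim A") auto
  \<comment> \<open>The choice \<open>d < c - 1\<close> makes the final exponent
    \<open>d - c\<close> smaller than -1 and the probabilities summable.\<close>
  then obtain d where d: "upper_box_dim A < ereal d" "d < c - 1"
    using ereal_dense2 by (metis ereal_less_eq(3) less_ereal.simps(1))
  define good where "good n \<longleftrightarrow> (\<exists>F. finite F \<and> real (card F) \<le> real n powr d \<and>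
           A \<subseteq> (\<Union>x\<in>F. cball x (1 / real n)))" for n
  define F where "F n = (SOME F. finite F \<and> real (card F) \<le> real n powr d \<and>
           A \<subseteq> (\<Union>x\<in>F. cball x (1 / real n)))" for n
  have F: "finite (F n) \<and> real (card (F n)) \<le> real n powr d \<and> A \<subseteq> (\<Union>x\<in>F n. cball x (1 / real n))"
    if "good n" for n
    using that unfolding good_def F_def by (rule someI_ex)
  \<comment> \<open>A point closer than \<open>\<rho> n\<close> to the center of a ball of radius
    \<open>1 / n\<close> covers the whole ball by its arc of radius \<open>l n / 2\<close>.\<close>
  define \<rho> where "\<rho> n = l n / 2 - 1 / real n" for n
  have "\<forall>\<^sub>F n in sequentially. 1 \<le> n \<and> 0 \<le> c * (ln (real n) / real n) / 2 - 1 / real n \<and> c * (ln (real n) / real n) / 2 - 1 / real n \<le> 1/2"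
    using c by (intro eventually_conj; real_asymp)
  then have ev: "\<forall>\<^sub>F n in sequentially. 1 \<le> n \<and> good n \<and> 0 \<le> \<rho> n \<and> \<rho> n \<le> 1/2"
    using upper_box_dim_less_imp_cover[OF d(1)]
    by eventually_elim (auto simp: good_def \<rho>_def l)
  define bad where "bad n = (\<Union>z\<in>F n. {x \<in> space M. \<forall>k\<in>{1..n}. X k x \<in> - ball z (\<rho> n)})" for n
  \<comment> \<open>\<open>F n\<close> is meaningful only for good \<open>n\<close>. The empty set
    for all other \<open>n\<close> makes the whole sequence measurable for Borel--Cantelli.\<close>
  define N where "N n = (if good n then bad n else {})" for n
  have sets_N: "N n \<in> sets M" for n
  proof (cases "good n")
    case True
    then show ?thesis
      unfolding N_def bad_def using F[OF True] by (simp only: if_True) (intro sets.finite_UN sets_forall_X; simp)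
  qed (simp add: N_def)
  have prob_N: "prob (N n) \<le> exp 2 * real n powr (d - c)"
    if n: "1 \<le> n" "good n" "0 \<le> \<rho> n" "\<rho> n \<le> 1/2" for n
  proof -
    interpret U: prob_space uniform_circle by (rule prob_space_uniform_circle)
    have "prob {x \<in> space M. \<forall>k\<in>{1..n}. X k x \<in> - ball z (\<rho> n)} \<le> exp 2 * real n powr (- c)" for z
    proof -
      have "U.prob (- ball z (\<rho> n)) = 1 - U.prob (ball z (\<rho> n))"
        using U.prob_compl[of "ball z (\<rho> n)"] by (simp add: Compl_eq_Diff_UNIV)
      also have "\<dots> \<le> 1 - 2 * \<rho> n"
        using measure_uniform_circle_ball_ge[OF n(3,4)] by simp
      also have "\<dots> \<le> exp (- 2 * \<rho> n)"
        using exp_ge_add_one_self[of "- 2 * \<rho> n"] by simp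
      finally have "U.prob (- ball z (\<rho> n)) ^ n \<le> exp (- 2 * \<rho> n) ^ n"
        by (intro power_mono) auto
      \<comment> \<open>As \<open>2 * \<rho> n * n = c * ln n - 2\<close>, shrinking the radius by
        \<open>1 / n\<close> costs only the constant factor \<open>exp 2\<close>.\<close>
      also have "\<dots> = exp (2 - c * ln (real n))"
        using n(1) by (simp add: exp_of_nat_mult[symmetric] \<rho>_def l field_simps)
      also have "\<dots> = exp 2 * real n powr (- c)"
        using n(1) by (simp add: powr_def exp_diff exp_minus divide_inverse)
      finally show ?thesis by (subst prob_forall_X) auto
    qed
    then have "prob (bad n) \<le> (\<Sum>z\<in>F n. exp 2 * real n powr (- c))"
      unfolding bad_def using F[OF n(2)]
      by (intro order_trans[OF finite_measure_subadditive_finite] sum_mono image_subsetI sets_forall_X) simp_all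
    also have "\<dots> = real (card (F n)) * (exp 2 * real n powr (- c))" by simp
    also have "\<dots> \<le> real n powr d * (exp 2 * real n powr (- c))"
      using F[OF n(2)] by (intro mult_right_mono) auto
    also have "\<dots> = exp 2 * real n powr (d - c)"
      by (simp add: powr_diff powr_minus field_simps)
    finally show ?thesis using n by (simp add: N_def)
  qed
  have "summable (\<lambda>n. prob (N n))"
  proof (rule summable_comparison_test_ev)
    show "\<forall>\<^sub>F n in sequentially. norm (prob (N n)) \<le> exp 2 * real n powr (d - c)"
      using ev by eventually_elim (use prob_N in auto)
    show "summable (\<lambda>n. exp 2 * real n powr (d - c))"
      using d(2) by (intro summable_mult) (simp add: summable_real_powr_iff)
  qed
  then have "AE x in M. \<forall>\<^sub>F n in sequentially. x \<in> space M - N n"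
    using sets_N by (intro borel_cantelli_AE1) (auto simp: emeasure_eq_measure)
  then show ?thesis
  proof eventually_elim
    case (elim x)
    have "\<forall>\<^sub>F n in sequentially. 1 \<le> n \<and> A \<subseteq> covered_upto l (\<lambda>k. X k x) n"
      using elim ev
    proof eventually_elim
      case (elim n)
      then have "x \<in> space M - bad n" by (simp add: N_def)
      have "A \<subseteq> covered_upto l (\<lambda>k. X k x) n"
      proof
        fix y assume "y \<in> A"
        then obtain z where z: "z \<in> F n" "dist z y \<le> 1 / real n"
          using F[of n] elim by auto
        then obtain k where k: "k \<in> {1..n}" "dist z (X k x) < \<rho> n"
          using \<open>x \<in> space M - bad n\<close> by (auto simp: bad_def)
        have "dist (X k x) y < l n / 2"
          using z(2) k(2) dist_triangle[of "X k x" y z] by (simp add: \<rho>_def dist_commute)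
        then show "y \<in> covered_upto l (\<lambda>k. X k x) n"
          using k(1) unfolding covered_upto_def by (intro UN_I[of k]) auto
      qed
      with elim show ?case by simp
    qed
    then obtain m where m: "\<And>n. n \<ge> m \<Longrightarrow> 1 \<le> n \<and> A \<subseteq> covered_upto l (\<lambda>k. X k x) n"
      unfolding eventually_sequentially by blast
    show "A \<subseteq> uniform_covering_set l (\<lambda>k. X k x)"
      unfolding uniform_covering_set_def using m by (intro subsetI UN_I[of m]) auto
  qed
qed

section \<open>Hausdorff measure and separated sets\<close>

lemma hausdorff_premeasure_le:
  assumes "A \<subseteq> (\<Union>i. U i)" "\<And>i. bounded (U i)" "\<And>i. diameter (U i) \<le> \<delta>"
  shows "hausdorff_premeasure s \<delta> A \<le> (\<Sum>i. diam_power s (U i))"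
  unfolding hausdorff_premeasure_def using assms by (intro INF_lower) auto

lemma hausdorff_premeasure_eq_0:
  assumes "hausdorff_measure s A = 0" "\<delta> > 0"
  shows "hausdorff_premeasure s \<delta> A = 0"
proof -
  have "hausdorff_premeasure s \<delta> A \<le> hausdorff_measure s A"
    unfolding hausdorff_measure_def using assms(2) by (intro SUP_upper) auto
  with assms(1) show ?thesis by simp
qed

lemma hausdorff_measure_mono:
  assumes "A \<subseteq> B"
  shows "hausdorff_measure s A \<le> hausdorff_measure s B"
  unfolding hausdorff_measure_def hausdorff_premeasure_def
  using assms by (intro SUP_mono' INF_superset_mono) auto

text \<open>The \<open>i\<close>-th set is covered at total cost below \<open>e / 2 ^ Suc i\<close>,
  and the resulting double sequence of covering sets is enumerated by
  \<open>prod_decode\<close>.\<close>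

lemma hausdorff_measure_UN_eq_0:
  fixes A :: "nat \<Rightarrow> 'a::metric_space set"
  assumes null: "\<And>i. hausdorff_measure s (A i) = 0"
  shows "hausdorff_measure s (\<Union>i. A i) = 0"
proof -
  have "hausdorff_premeasure s \<delta> (\<Union>i. A i) \<le> ennreal e" if "\<delta> > 0" "e > 0" for \<delta> e
  proof -
    have "\<exists>U. A i \<subseteq> (\<Union>j. U j) \<and> (\<forall>j. bounded (U j) \<and> diameter (U j) \<le> \<delta>) \<and>
            (\<Sum>j. diam_power s (U j)) < ennreal (e * (1/2) ^ Suc i)" for i
    proof -
      have "hausdorff_premeasure s \<delta> (A i) < ennreal (e * (1/2) ^ Suc i)"
        using hausdorff_premeasure_eq_0[OF null that(1)] that(2) by (simp add: ennreal_zero_less_mult_iff)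
      then show ?thesis
        unfolding hausdorff_premeasure_def Inf_less_iff by auto
    qed
    then obtain U where U: "\<And>i. A i \<subseteq> (\<Union>j. U i j)" "\<And>i j. bounded (U i j)" "\<And>i j. diameter (U i j) \<le> \<delta>"
      "\<And>i. (\<Sum>j. diam_power s (U i j)) < ennreal (e * (1/2) ^ Suc i)"
      by metis
    define V where "V k = case_prod U (prod_decode k)" for k
    have "(\<Union>i. A i) \<subseteq> (\<Union>k. V k)"
    proof
      fix x assume "x \<in> (\<Union>i. A i)"
      then obtain i j where "x \<in> U i j" using U(1) by blast
      then have "x \<in> V (prod_encode (i, j))" by (simp add: V_def)
      then show "x \<in> (\<Union>k. V k)" by blast
    qed
    then have "hausdorff_premeasure s \<delta> (\<Union>i. A i) \<le> (\<Sum>k. diam_power s (V k))"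
      using U by (intro hausdorff_premeasure_le) (auto simp: V_def split: prod.split)
    also have "\<dots> = (\<Sum>k. (\<lambda>(i, j). diam_power s (U i j)) (prod_decode k))"
      by (simp add: V_def case_prod_beta)
    also have "\<dots> = (\<Sum>i. \<Sum>j. diam_power s (U i j))"
      by (intro suminf_ennreal_2dimen) simp
    also have "\<dots> \<le> (\<Sum>i. ennreal (e * (1/2) ^ Suc i))"
      using U(4) by (intro suminf_le) (auto intro: less_imp_le)
    also have "\<dots> = ennreal e"
      using that(2) sums_mult[OF power_half_series, of e] by (intro suminf_ennreal_eq) auto
    finally show ?thesis .
  qed
  then have "hausdorff_premeasure s \<delta> (\<Union>i. A i) = 0" if "\<delta> > 0" for \<delta>
    using that ennreal_le_epsilon[of 0 "hausdorff_premeasure s \<delta> (\<Union>i. A i)"] by (simp add: le_zero_eq[symmetric] del: le_zero_eq)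
  then show ?thesis
    unfolding hausdorff_measure_def by simp
qed

text \<open>Read as its contrapositive, it turns a dimension above \<open>c\<close> into an exponent
  \<open>s > c\<close> of nonzero measure.\<close>

lemma hausdorff_dim_le:
  assumes "0 \<le> c" and "\<And>s. c < s \<Longrightarrow> hausdorff_measure s A = 0"
  shows "hausdorff_dim A \<le> ereal c"
proof (rule ereal_le_epsilon2)
  fix e :: real assume "0 < e"
  then show "hausdorff_dim A \<le> ereal c + ereal e"
    using assms unfolding hausdorff_dim_def by (auto intro!: INF_lower)
qed

text \<open>The strict inequality makes the closed balls of radius \<open>\<delta> / 2\<close>
  around the points disjoint.\<close>

definition separated :: "real \<Rightarrow> 'a::metric_space set \<Rightarrow> bool" where
  "separated \<delta> F \<longleftrightarrow> pairwise (\<lambda>x y. \<delta> < dist x y) F"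

text \<open>A maximal separated set is a net, whose balls are admissible in the premeasure. If there is
  no maximal one, then separated sets of any size exist.\<close>

lemma exists_large_separated:
  assumes "0 < \<delta>" "2 * \<delta> \<le> \<delta>\<^sub>0" "s > 0" and \<eta>: "ennreal \<eta> < hausdorff_premeasure s \<delta>\<^sub>0 A"
  shows "\<exists>F. finite F \<and> F \<subseteq> A \<and> separated \<delta> F \<and> \<eta> \<le> real (card F) * (2 * \<delta>) powr s"
proof (rule ccontr)
  assume neg: "\<not> ?thesis"
  define P where "P m \<longleftrightarrow> (\<exists>F. finite F \<and> F \<subseteq> A \<and> separated \<delta> F \<and> card F = m)" for m
  have P0: "P 0"
    unfolding P_def by (intro exI[of _ "{}"]) (simp add: separated_def)
  \<comment> \<open>The negated claim bounds the size of separated subsets, so that one of maximal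
    size exists.\<close>
  have "m \<le> nat \<lceil>\<eta> / (2 * \<delta>) powr s\<rceil>" if "P m" for m
  proof -
    have "real m * (2 * \<delta>) powr s < \<eta>"
      using that neg unfolding P_def by (auto simp: not_le)
    then have "real m < \<eta> / (2 * \<delta>) powr s"
      using assms by (simp add: field_simps)
    then show ?thesis by linarith
  qed
  then obtain m where m: "P m" "\<And>k. P k \<Longrightarrow> k \<le> m"
    using GreatestI_nat[of P 0, OF P0] Greatest_le_nat[of P] by metis
  then obtain F where F: "finite F" "F \<subseteq> A" "separated \<delta> F" "card F = m"
    unfolding P_def by auto
  have net: "\<exists>y\<in>F. dist y x \<le> \<delta>" if x: "x \<in> A" for x
  proof (rule ccontr)
    assume far: "\<not> ?thesis"
    then have "x \<notin> F" using assms(1) by force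
    moreover have "separated \<delta> (insert x F)"
      using F(3) far unfolding separated_def pairwise_insert by (auto simp: dist_commute not_le)
    ultimately have "P (Suc m)"
      using F x unfolding P_def by (intro exI[of _ "insert x F"]) auto
    then show False using m(2) by fastforce
  qed
  obtain f where f: "bij_betw f {..<m} F"
    using F(1,4) by (metis ex_bij_betw_nat_finite atLeast0LessThan)
  \<comment> \<open>The premeasure asks for infinite sequences. The finite cover is padded with
    empty sets, whose \<open>diam_power\<close> is 0.\<close>
  define U where "U i = (if i < m then cball (f i) \<delta> else {})" for i
  have diam: "diameter (cball y \<delta>) \<le> 2 * \<delta>" for y :: 'a
  proof -
    have "dist a b \<le> 2 * \<delta>" if "a \<in> cball y \<delta>" "b \<in> cball y \<delta>" for a b
      using that dist_triangle3[of a b y] by simp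
    then show ?thesis
      using assms(1) by (auto simp: diameter_def intro!: cSUP_least)
  qed
  have "hausdorff_premeasure s \<delta>\<^sub>0 A \<le> (\<Sum>i. diam_power s (U i))"
  proof (rule hausdorff_premeasure_le)
    show "A \<subseteq> (\<Union>i. U i)"
    proof
      fix x assume "x \<in> A"
      then obtain y where "y \<in> F" "dist y x \<le> \<delta>" using net by auto
      moreover from \<open>y \<in> F\<close> obtain i where "i < m" "f i = y"
        using f by (metis bij_betw_imp_surj_on imageE lessThan_iff)
      ultimately have "x \<in> U i" by (simp add: U_def)
      then show "x \<in> (\<Union>i. U i)" by blast
    qed
    show "diameter (U i) \<le> \<delta>\<^sub>0" for i
      using diam[of "f i"] assms by (auto simp: U_def)
  qed (auto simp: U_def)
  also have "\<dots> = (\<Sum>i<m. diam_power s (U i))"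
    by (intro suminf_finite) (auto simp: U_def diam_power_def)
  also have "\<dots> \<le> (\<Sum>i<m. ennreal ((2 * \<delta>) powr s))"
  proof (rule sum_mono)
    fix i
    have "diam_power s (U i) \<le> ennreal (diameter (cball (f i) \<delta>) powr s)" 
      using assms(3) by (simp add: U_def diam_power_def)
    also have "\<dots> \<le> ennreal ((2 * \<delta>) powr s)"
      using diam[of "f i"] assms by (intro ennreal_leI powr_mono2) (auto simp: diameter_ge_0)
    finally show "diam_power s (U i) \<le> ennreal ((2 * \<delta>) powr s)" .
  qed
  also have "\<dots> = ennreal (real m * (2 * \<delta>) powr s)"
    by (simp add: ennreal_mult ennreal_of_nat_eq_real_of_nat)
  also have "\<dots> \<le> ennreal \<eta>"
    using neg F by (intro ennreal_leI) (auto simp: not_le)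
  finally show False using \<eta> by simp
qed

section \<open>Second moment estimates\<close>

text \<open>Chebyshev's inequality for the number \<open>Z\<close> of events that occur: without
  positive correlations the variance of \<open>Z\<close> is at most its mean \<open>m\<close>, and
  if no event occurs, \<open>Z\<close> deviates from its mean by \<open>m\<close>.\<close>

lemma (in prob_space) prob_no_event_le:
  assumes F: "finite F" and S: "\<And>i. i \<in> F \<Longrightarrow> S i \<in> events"
    and corr: "\<And>i j. i \<in> F \<Longrightarrow> j \<in> F \<Longrightarrow> i \<noteq> j \<Longrightarrow> prob (S i \<inter> S j) \<le> prob (S i) * prob (S j)"
    and pos: "0 < (\<Sum>i\<in>F. prob (S i))"
  shows "prob {x \<in> space M. \<forall>i\<in>F. x \<notin> S i} \<le> 1 / (\<Sum>i\<in>F. prob (S i))"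
proof -
  define m where "m = (\<Sum>i\<in>F. prob (S i))"
  define Z where "Z x = (\<Sum>i\<in>F. indicat_real (S i) x)" for x
  have int_ind: "integrable M (indicat_real B)" if "B \<in> events" for B
    using that by (simp add: integrable_real_indicator emeasure_eq_measure)
  have ZZ: "(Z x)\<^sup>2 = (\<Sum>i\<in>F. \<Sum>j\<in>F. indicat_real (S i \<inter> S j) x)" for x
    by (simp add: Z_def power2_eq_square sum_product indicator_inter_arith)
  have intZ: "integrable M Z" and intZ2: "integrable M (\<lambda>x. (Z x)\<^sup>2)"
    unfolding ZZ unfolding Z_def using S by (auto intro!: Bochner_Integration.integrable_sum int_ind)
  have EZ: "expectation Z = m"
    unfolding Z_def m_def using S
    by (subst Bochner_Integration.integral_sum) (auto intro!: int_ind)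
  have "expectation (\<lambda>x. (Z x)\<^sup>2) = (\<Sum>i\<in>F. \<Sum>j\<in>F. prob (S i \<inter> S j))"
  proof -
    have int: "integrable M (indicat_real (S i \<inter> S j))" if "i \<in> F" "j \<in> F" for i j
      using S that by (intro int_ind) auto
    have "expectation (\<lambda>x. (Z x)\<^sup>2) = (\<Sum>i\<in>F. expectation (\<lambda>x. \<Sum>j\<in>F. indicat_real (S i \<inter> S j) x))"
      unfolding ZZ using int by (intro Bochner_Integration.integral_sum Bochner_Integration.integrable_sum)
    also have "\<dots> = (\<Sum>i\<in>F. \<Sum>j\<in>F. expectation (indicat_real (S i \<inter> S j)))"
      using int by (intro sum.cong refl Bochner_Integration.integral_sum)
    also have "\<dots> = (\<Sum>i\<in>F. \<Sum>j\<in>F. prob (S i \<inter> S j))"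
      using S by (intro sum.cong refl) simp
    finally show ?thesis .
  qed
  \<comment> \<open>The extra summand pays for the diagonal, where
    \<open>prob (S i \<inter> S i) = prob (S i)\<close>.\<close>
  also have "\<dots> \<le> (\<Sum>i\<in>F. \<Sum>j\<in>F. prob (S i) * prob (S j) + (if i = j then prob (S i) else 0))"
    using corr by (intro sum_mono) auto
  also have "\<dots> = m\<^sup>2 + m"
    using F by (simp add: sum.distrib m_def power2_eq_square sum_product)
  finally have "variance Z \<le> m"
    unfolding variance_eq[OF intZ intZ2] unfolding EZ by simp
  have "prob {x \<in> space M. \<forall>i\<in>F. x \<notin> S i} \<le> prob {x \<in> space M. m \<le> \<bar>Z x - expectation Z\<bar>}"
  proof (rule finite_measure_mono)
    show "{x \<in> space M. \<forall>i\<in>F. x \<notin> S i} \<subseteq> {x \<in> space M. m \<le> \<bar>Z x - expectation Z\<bar>}"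
      using pos by (auto simp: Z_def EZ m_def)
    show "{x \<in> space M. m \<le> \<bar>Z x - expectation Z\<bar>} \<in> events"
      using borel_measurable_integrable[OF intZ] by measurable
  qed
  also have "\<dots> \<le> variance Z / m\<^sup>2"
    using intZ2 pos borel_measurable_integrable[OF intZ]
    by (intro Chebyshev_inequality) (auto simp: m_def)
  also have "\<dots> \<le> m / m\<^sup>2"
    using \<open>variance Z \<le> m\<close> by (intro divide_right_mono) auto
  finally show ?thesis
    using pos by (simp add: m_def power2_eq_square)
qed

text \<open>Let \<open>S y\<close> be the event that \<open>y\<close> stays uncovered. The balls
  around distinct points of \<open>F\<close> are disjoint, and
  \<open>1 - p - q \<le> (1 - p) * (1 - q)\<close> shows that these events are not positively
  correlated. Each has probability at least \<open>(1 - 2 * r) ^ n\<close>.\<close>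

lemma (in iid_uniform) prob_separated_covered_le:
  assumes F: "finite F" "separated (2 * r) F" "F \<noteq> {}" and r: "0 \<le> r" "r < 1/2"
  shows "prob {x \<in> space M. \<forall>y\<in>F. \<exists>k\<in>{1..n}. dist y (X k x) \<le> r} \<le> 1 / (real (card F) * (1 - 2 * r) ^ n)"
proof -
  interpret U: prob_space uniform_circle by (rule prob_space_uniform_circle)
  define S where "S y = {x \<in> space M. \<forall>k\<in>{1..n}. X k x \<in> - cball y r}" for y
  have S [measurable]: "S y \<in> events" for y
    unfolding S_def by (intro sets_forall_X) auto
  have compl: "U.prob (- B) = 1 - U.prob B" if "B \<in> sets borel" for B
    using U.prob_compl[of B] that by (simp add: Compl_eq_Diff_UNIV)
  have PS: "prob (S y) = (1 - U.prob (cball y r)) ^ n" for y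
    unfolding S_def by (subst prob_forall_X) (auto simp: compl)
  have ge: "(1 - 2 * r) ^ n \<le> prob (S y)" for y
    unfolding PS using measure_uniform_circle_cball_le[of r y] r by (intro power_mono) auto
  then have "real (card F) * (1 - 2 * r) ^ n \<le> (\<Sum>y\<in>F. prob (S y))"
    using sum_mono[of F "\<lambda>_. (1 - 2 * r) ^ n" "\<lambda>y. prob (S y)"] by simp
  moreover have pos: "0 < real (card F) * (1 - 2 * r) ^ n"
    using F r by (simp add: card_gt_0_iff)
  moreover have "prob {x \<in> space M. \<forall>y\<in>F. x \<notin> S y} \<le> 1 / (\<Sum>y\<in>F. prob (S y))"
  proof (rule prob_no_event_le)
    fix y z assume yz: "y \<in> F" "z \<in> F" "y \<noteq> z"
    have disj: "cball y r \<inter> cball z r = {}"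
    proof (rule ccontr)
      assume "\<not> ?thesis"
      then obtain u where "dist y u \<le> r" "dist z u \<le> r" by auto
      then have "dist y z \<le> 2 * r" using dist_triangle2[of y z u] by linarith
      with F(2) yz show False unfolding separated_def pairwise_def by force
    qed
    have eq: "S y \<inter> S z = {x \<in> space M. \<forall>k\<in>{1..n}. X k x \<in> - (cball y r \<union> cball z r)}"
      by (auto simp: S_def)
    have sum: "U.prob (cball y r \<union> cball z r) = U.prob (cball y r) + U.prob (cball z r)"
      using disj by (intro U.finite_measure_Union) auto
    have "U.prob (- (cball y r \<union> cball z r)) = 1 - U.prob (cball y r \<union> cball z r)"
      by (rule compl) auto
    also have "\<dots> \<le> (1 - U.prob (cball y r)) * (1 - U.prob (cball z r))"
      unfolding sum by (simp add: algebra_simps)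
    finally have "U.prob (- (cball y r \<union> cball z r)) ^ n \<le> ((1 - U.prob (cball y r)) * (1 - U.prob (cball z r))) ^ n"
      by (intro power_mono) auto
    moreover have "prob {x \<in> space M. \<forall>k\<in>{1..n}. X k x \<in> - (cball y r \<union> cball z r)} = U.prob (- (cball y r \<union> cball z r)) ^ n"
      by (rule prob_forall_X) auto
    ultimately show "prob (S y \<inter> S z) \<le> prob (S y) * prob (S z)"
      unfolding eq PS power_mult_distrib[symmetric] by simp
  qed (use F(1) pos calculation(1) in auto)
  moreover have "{x \<in> space M. \<forall>y\<in>F. \<exists>k\<in>{1..n}. dist y (X k x) \<le> r} = {x \<in> space M. \<forall>y\<in>F. x \<notin> S y}"
    by (auto simp: S_def)
  ultimately show ?thesis
    by (smt (verit) divide_left_mono frac_le)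
qed

text \<open>The numerator is of order \<open>n powr (- c)\<close>, while \<open>l n\<close> is of
  order \<open>ln n / n\<close>, so the quotient is \<open>n powr (s - c)\<close> up to logarithmic
  factors. Up to a constant it bounds the expected number of uncovered points from below.\<close>

lemma uncovered_expectation_at_top:
  fixes c s :: real
  assumes "0 < c" "c < s"
  defines "l \<equiv> \<lambda>n. c * (ln (real n) / real n)"
  shows "filterlim (\<lambda>n. (1 - l n) ^ n / (2 * l n) powr s) at_top sequentially"
proof (rule filterlim_at_top_mono)
  \<comment> \<open>This minorant comes from \<open>exp (- t - 2 * t^2) \<le> 1 - t\<close> for
    \<open>0 \<le> t \<le> 1/2\<close>. Raised to the power \<open>n\<close>, the quadratic term
    becomes an error that tends to 0.\<close>
  show "filterlim (\<lambda>n. exp (- c * ln (real n) - 2 * c\<^sup>2 * (ln (real n))\<^sup>2 / real n) / (2 * l n) powr s) at_top sequentially"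
    unfolding l_def using assms by real_asymp
  have "\<forall>\<^sub>F n in sequentially. n \<ge> 1 \<and> 0 \<le> l n \<and> l n \<le> 1/2"
    unfolding l_def using assms by (intro eventually_conj; real_asymp)
  then show "\<forall>\<^sub>F n in sequentially. exp (- c * ln (real n) - 2 * c\<^sup>2 * (ln (real n))\<^sup>2 / real n) / (2 * l n) powr s
      \<le> (1 - l n) ^ n / (2 * l n) powr s"
  proof eventually_elim
    case (elim n)
    have "exp (- l n - 2 * (l n)\<^sup>2) \<le> 1 - l n"
      using ln_one_minus_pos_lower_bound[of "l n"] elim 
      by (simp add: ln_ge_iff)
    then have "exp (- l n - 2 * (l n)\<^sup>2) ^ n \<le> (1 - l n) ^ n"
      by (intro power_mono) auto
    moreover have "exp (- l n - 2 * (l n)\<^sup>2) ^ n = exp (- c * ln (real n) - 2 * c\<^sup>2 * (ln (real n))\<^sup>2 / real n)"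
      using elim by (simp add: exp_of_nat_mult[symmetric] l_def field_simps power2_eq_square)
    ultimately show ?case by (intro divide_right_mono) auto
  qed
qed

text \<open>For all large \<open>n\<close> the set \<open>K\<close> contains an
  \<open>l n\<close>-separated set of at least \<open>\<eta> / (2 * l n) powr s\<close> points, and
  on \<open>G\<close> all of them are covered at time \<open>n\<close>. The second moment bound for
  this event tends to 0.\<close>

lemma (in iid_uniform) prob_closed_covered_eq_0:
  assumes c: "0 < c" "c < s" and l: "\<And>n. n \<ge> 1 \<Longrightarrow> l n = c * (ln (real n) / real n)"
    and K: "hausdorff_measure s K \<noteq> 0"
    and G: "G \<in> events" "\<And>x y n. x \<in> G \<Longrightarrow> y \<in> K \<Longrightarrow> n \<ge> N \<Longrightarrow> \<exists>k\<in>{1..n}. dist y (X k x) \<le> l n / 2"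
  shows "prob G = 0"
proof (rule antisym[OF field_le_epsilon])
  fix e :: real assume "0 < e"
  have "0 < hausdorff_measure s K"
    using K by (simp add: zero_less_iff_neq_zero)
  then obtain \<delta>\<^sub>0 where \<delta>\<^sub>0: "\<delta>\<^sub>0 > 0" "0 < hausdorff_premeasure s \<delta>\<^sub>0 K"
    unfolding hausdorff_measure_def less_SUP_iff by auto
  \<comment> \<open>A value strictly below the premeasure is finite, even if the premeasure is
    infinite.\<close>
  then obtain h where h: "0 < h" "h < hausdorff_premeasure s \<delta>\<^sub>0 K"
    using dense by blast
  then obtain \<eta> where \<eta>: "0 < \<eta>" "ennreal \<eta> < hausdorff_premeasure s \<delta>\<^sub>0 K"
    by (cases h) auto
  let ?l = "\<lambda>n. c * (ln (real n) / real n)"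
  \<comment> \<open>With this threshold the expected number of uncovered points is at least
    \<open>1 / e\<close>, so that the second moment bound is at most \<open>e\<close>.\<close>
  have "\<forall>\<^sub>F n in sequentially. 1 / (e * \<eta>) \<le> (1 - ?l n) ^ n / (2 * ?l n) powr s"
    using uncovered_expectation_at_top[OF c] unfolding filterlim_at_top by simp
  moreover have "\<forall>\<^sub>F n in sequentially. n \<ge> max N 1 \<and> 0 < ?l n \<and> 2 * ?l n \<le> \<delta>\<^sub>0 \<and> ?l n < 1"
    using c \<delta>\<^sub>0(1) by (intro eventually_conj eventually_ge_at_top; real_asymp)
  ultimately have "\<forall>\<^sub>F n in sequentially. 1 / (e * \<eta>) \<le> (1 - ?l n) ^ n / (2 * ?l n) powr s \<and>
      n \<ge> max N 1 \<and> 0 < ?l n \<and> 2 * ?l n \<le> \<delta>\<^sub>0 \<and> ?l n < 1"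
    by eventually_elim auto
  from eventually_happens'[OF sequentially_bot this]
  obtain n where n: "1 / (e * \<eta>) \<le> (1 - ?l n) ^ n / (2 * ?l n) powr s" "n \<ge> N" "n \<ge> 1"
      "0 < ?l n" "2 * ?l n \<le> \<delta>\<^sub>0" "?l n < 1"
    by auto
  note n = n(2) n(1,4-6)[folded l[OF n(3)]]
  obtain F where F: "finite F" "F \<subseteq> K" "separated (l n) F" "\<eta> \<le> real (card F) * (2 * l n) powr s"
    using exists_large_separated[OF n(3,4) _ \<eta>(2)] c by auto
  have "F \<noteq> {}" using F(4) \<eta>(1) by auto
  have ev: "{x \<in> space M. dist y (X k x) \<le> l n / 2} \<in> events" if "k \<in> {1..n}" for k y
    using measurable_sets[OF measurable_X borel_closed[OF closed_cball], of k y "l n / 2"] that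
    by (simp add: vimage_def Int_def conj_commute)
  have "prob G \<le> prob {x \<in> space M. \<forall>y\<in>F. \<exists>k\<in>{1..n}. dist y (X k x) \<le> l n / 2}"
  proof (rule finite_measure_mono)
    show "G \<subseteq> {x \<in> space M. \<forall>y\<in>F. \<exists>k\<in>{1..n}. dist y (X k x) \<le> l n / 2}"
      using G sets.sets_into_space[OF G(1)] F(2) n(1) by blast
    show "{x \<in> space M. \<forall>y\<in>F. \<exists>k\<in>{1..n}. dist y (X k x) \<le> l n / 2} \<in> events"
      using F(1) by (intro sets.sets_Collect_finite_All sets.sets_Collect_finite_Ex ev) simp_all
  qed
  also have "\<dots> \<le> 1 / (real (card F) * (1 - 2 * (l n / 2)) ^ n)"
    using F \<open>F \<noteq> {}\<close> n by (intro prob_separated_covered_le) auto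
  also have "\<dots> \<le> e"
  proof -
    have "1 / e = \<eta> * (1 / (e * \<eta>))" using \<eta>(1) by simp
    also have "\<dots> \<le> (real (card F) * (2 * l n) powr s) * ((1 - l n) ^ n / (2 * l n) powr s)"
      using F(4) n(2) \<eta>(1) \<open>0 < e\<close> by (intro mult_mono) auto
    also have "\<dots> = real (card F) * (1 - l n) ^ n"
      using n(3) by simp
    finally show ?thesis
      using \<open>0 < e\<close> \<open>F \<noteq> {}\<close> F(1) n(5) by (simp add: field_simps card_gt_0_iff)
  qed
  finally show "prob G \<le> 0 + e" by simp
qed simp

section \<open>Analytic sets\<close>

text \<open>Closed subsets of \<open>\<real>\<^sup>\<nat>\<close> as parameter spaces, instead of the usual Baire space, make \<open>\<real>/\<int>\<close> and its
  countable powers analytic at once through \<^const>\<open>to_circle\<close>.\<close>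

definition analytic :: "'a::topological_space set \<Rightarrow> bool" where
  "analytic S \<longleftrightarrow> (\<exists>(C :: (nat \<Rightarrow> real) set) f. closed C \<and> continuous_on C f \<and> f ` C = S)"

lemma analytic_empty: "analytic {}"
  unfolding analytic_def by (intro exI[of _ "{}"]) auto

lemma analytic_image: "analytic (g ` S)" if S: "analytic S" and g: "continuous_on S g"
proof -
  obtain C :: "(nat \<Rightarrow> real) set" and f where C: "closed C" "continuous_on C f" "f ` C = S"
    using S unfolding analytic_def by blast
  have "continuous_on C (\<lambda>z. g (f z))"
    using continuous_on_compose2[OF g C(2)] C(3) by simp
  moreover have "(\<lambda>z. g (f z)) ` C = g ` S" using C(3) by auto
  ultimately show ?thesis
    using C(1) unfolding analytic_def by blast
qed

lemma continuous_on_reindex: "continuous_on S (\<lambda>z :: nat \<Rightarrow> real. \<lambda>k. z (h k))"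
  by (intro continuous_on_coordinatewise_then_product continuous_on_subset[OF continuous_on_product_coordinates]) simp

lemma closed_vimage_reindex: "closed {z :: nat \<Rightarrow> real. (\<lambda>k. z (h k)) \<in> C}" if "closed C"
  using closed_vimage[OF that continuous_on_reindex[of UNIV h]] by (simp add: vimage_def)

text \<open>Coordinate 0 of the new parameter holds the index \<open>n\<close>, the shifted sequence
  the parameter for \<open>S n\<close>.\<close>

lemma analytic_UN:
  fixes S :: "nat \<Rightarrow> 'a::topological_space set"
  assumes "\<And>n. analytic (S n)"
  shows "analytic (\<Union>n. S n)"
proof -
  obtain C :: "nat \<Rightarrow> (nat \<Rightarrow> real) set" and f where
    C: "\<And>n. closed (C n)" "\<And>n. continuous_on (C n) (f n)" "\<And>n. f n ` C n = S n"
    using assms unfolding analytic_def by metis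
  define tl where "tl z = (\<lambda>k. z (Suc k))" for z :: "nat \<Rightarrow> real"
  define D where "D n = {z. z 0 = real n \<and> tl z \<in> C n}" for n
  define g where "g z = f (nat \<lfloor>z 0\<rfloor>) (tl z)" for z
  \<comment> \<open>At most one integer lies within \<open>1/2\<close> of \<open>z 0\<close>, so
    this neighborhood meets at most one \<open>D n\<close>. Closedness of the union and continuity
    of \<open>g\<close> can therefore be checked on a single \<open>D n\<close>.\<close>
  define U where "U (z :: nat \<Rightarrow> real) = {z' :: nat \<Rightarrow> real. \<bar>z' 0 - z 0\<bar> < 1/2}" for z
  have cont0: "continuous_on T (\<lambda>z :: nat \<Rightarrow> real. z 0)" for T
    by (rule continuous_on_subset[OF continuous_on_product_coordinates]) simp
  have U_open: "open (U z)" for z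
    unfolding U_def by (intro open_Collect_less continuous_intros cont0)
  have D_closed: "closed (D n)" for n
    unfolding D_def tl_def using closed_vimage_reindex[OF C(1), of Suc n]
    by (intro closed_Collect_conj closed_Collect_eq cont0) (auto intro: continuous_intros)
  have near: "\<exists>n. (\<Union>n. D n) \<inter> U z \<subseteq> D n" for z
  proof (cases "(\<Union>n. D n) \<inter> U z = {}")
    case False
    then obtain n z' where z': "z' \<in> D n" "z' \<in> U z" by auto
    have "m = n" if "w \<in> D m" "w \<in> U z" for w m
    proof -
      have "\<bar>real m - z 0\<bar> < 1/2" "\<bar>real n - z 0\<bar> < 1/2"
        using that z' by (auto simp: D_def U_def)
      then show ?thesis by linarith
    qed
    then show ?thesis by blast
  qed auto
  have "closed (\<Union>n. D n)"
  proof (rule closure_subset_eq[THEN iffD1, OF subsetI])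
    fix z assume z: "z \<in> closure (\<Union>n. D n)"
    obtain n where n: "(\<Union>n. D n) \<inter> U z \<subseteq> D n" using near by blast
    have "z \<in> U z \<inter> closure (\<Union>n. D n)" using z by (simp add: U_def)
    then have "z \<in> closure (U z \<inter> (\<Union>n. D n))"
      using open_Int_closure_subset[OF U_open] by blast
    also have "\<dots> \<subseteq> D n"
      using n D_closed by (intro closure_minimal) auto
    finally show "z \<in> (\<Union>n. D n)" by blast
  qed
  moreover have "continuous_on (\<Union>n. D n) g"
    unfolding continuous_on_def
  proof
    fix z assume z: "z \<in> (\<Union>n. D n)"
    obtain n where n: "(\<Union>n. D n) \<inter> U z \<subseteq> D n" using near by blast
    have "z \<in> U z" by (simp add: U_def)
    then have "z \<in> D n" using z n by blast
    have "continuous_on (D n) (\<lambda>z. f n (tl z))"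
      by (rule continuous_on_compose2[OF C(2)]) (auto simp: D_def tl_def intro: continuous_on_reindex)
    then have "continuous_on (D n) g"
      by (rule continuous_on_eq) (auto simp: D_def g_def)
    then have "(g \<longlongrightarrow> g z) (at z within D n)"
      using \<open>z \<in> D n\<close> by (simp add: continuous_on_def)
    moreover have "at z within D n = at z within (\<Union>n. D n)"
      using n by (intro at_within_nhd[OF _ U_open[of z]]) (use \<open>z \<in> U z\<close> in auto)
    ultimately show "(g \<longlongrightarrow> g z) (at z within (\<Union>n. D n))" by simp
  qed
  moreover have "g ` (\<Union>n. D n) = (\<Union>n. S n)"
  proof (intro equalityI subsetI)
    fix x assume "x \<in> g ` (\<Union>n. D n)"
    then obtain n z where "z \<in> D n" "x = g z" by blast
    then have "x \<in> f n ` C n" by (auto simp: D_def g_def)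
    then show "x \<in> (\<Union>n. S n)" using C(3) by blast
  next
    fix x assume "x \<in> (\<Union>n. S n)"
    then obtain n where "x \<in> S n" by blast
    then obtain y where y: "y \<in> C n" "x = f n y" using C(3)[of n] by blast
    define z where "z k = (case k of 0 \<Rightarrow> real n | Suc k \<Rightarrow> y k)" for k
    have "tl z = y" "z 0 = real n" by (auto simp: tl_def z_def)
    with y have "z \<in> D n" "x = g z" by (auto simp: D_def g_def)
    then show "x \<in> g ` (\<Union>n. D n)" by blast
  qed
  ultimately show ?thesis
    unfolding analytic_def by blast
qed

text \<open>One sequence encodes countably many parameters, one for each \<open>S n\<close>. The
  points whose parameters all have the same image form a closed set.\<close>

lemma analytic_INT:
  fixes S :: "nat \<Rightarrow> 'a::metric_space set"
  assumes "\<And>n. analytic (S n)"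
  shows "analytic (\<Inter>n. S n)"
proof -
  obtain C :: "nat \<Rightarrow> (nat \<Rightarrow> real) set" and f where
    C: "\<And>n. closed (C n)" "\<And>n. continuous_on (C n) (f n)" "\<And>n. f n ` C n = S n"
    using assms unfolding analytic_def by metis
  define p where "p n z = (\<lambda>k. z (prod_encode (n, k)))" for n and z :: "nat \<Rightarrow> real"
  define E where "E = (\<Inter>n. {z. p n z \<in> C n})"
  have E: "closed E"
    unfolding E_def p_def by (intro closed_INT ballI closed_vimage_reindex C)
  have cont: "continuous_on E (\<lambda>z. f n (p n z))" for n
    by (rule continuous_on_compose2[OF C(2)]) (auto simp: E_def p_def intro: continuous_on_reindex)
  \<comment> \<open>Equality is written as a vanishing distance, so that each condition is the
    preimage of a point under a continuous real function on \<open>E\<close>.\<close>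
  define D where "D = (\<Inter>n. {z \<in> E. dist (f n (p n z)) (f 0 (p 0 z)) = 0})"
  have "closed D"
    unfolding D_def using E
    by (intro closed_INT ballI continuous_closed_preimage_constant continuous_on_dist cont)
  moreover have "continuous_on D (\<lambda>z. f 0 (p 0 z))"
    by (rule continuous_on_subset[OF cont]) (auto simp: D_def)
  moreover have "(\<lambda>z. f 0 (p 0 z)) ` D = (\<Inter>n. S n)"
  proof (intro equalityI subsetI)
    fix x assume "x \<in> (\<lambda>z. f 0 (p 0 z)) ` D"
    then obtain z where z: "z \<in> D" "x = f 0 (p 0 z)" by blast
    have "x = f n (p n z) \<and> p n z \<in> C n" for n
    proof -
      have "dist (f n (p n z)) (f 0 (p 0 z)) = 0" "p n z \<in> C n"
        using z(1) unfolding D_def E_def by blast+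
      then show ?thesis by (simp add: z(2))
    qed
    then show "x \<in> (\<Inter>n. S n)" using C(3) by blast
  next
    fix x assume "x \<in> (\<Inter>n. S n)"
    then have "\<exists>y\<in>C n. x = f n y" for n
      using C(3)[of n] by blast
    then obtain y where y: "\<And>n. y n \<in> C n" "\<And>n. x = f n (y n)" by metis
    define z where "z m = case_prod y (prod_decode m)" for m
    have "p n z = y n" for n by (simp add: p_def z_def)
    then have "z \<in> D" "x = f 0 (p 0 z)"
      using y by (auto simp: D_def E_def simp flip: y(2))
    then show "x \<in> (\<lambda>z. f 0 (p 0 z)) ` D" by blast
  qed
  ultimately show ?thesis
    unfolding analytic_def by blast
qed

lemma analytic_closed:
  fixes S :: "'a::metric_space set"
  assumes "analytic (UNIV :: 'a set)" "closed S"
  shows "analytic S"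
proof -
  obtain C :: "(nat \<Rightarrow> real) set" and f :: "_ \<Rightarrow> 'a" where C: "closed C" "continuous_on C f" "f ` C = UNIV"
    using assms(1) unfolding analytic_def by blast
  have "closed (C \<inter> f -` S)"
    using C assms(2) by (intro continuous_closed_preimage)
  moreover have "continuous_on (C \<inter> f -` S) f"
    using C(2) by (rule continuous_on_subset) auto
  moreover have "f ` (C \<inter> f -` S) = f ` C \<inter> S" by auto
  then have "f ` (C \<inter> f -` S) = S" using C(3) by simp
  ultimately show ?thesis
    unfolding analytic_def by blast
qed

text \<open>The sets that are analytic together with their complements form a \<sigma>-algebra. It
  contains the closed sets, since open sets in a metric space are countable unions of closed
  ones.\<close>

lemma analytic_borel:
  fixes S :: "'a::metric_space set"
  assumes U: "analytic (UNIV :: 'a set)" and S: "S \<in> sets borel"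
  shows "analytic S"
proof -
  have "S \<in> sigma_sets UNIV (Collect closed)"
    using S by (simp add: borel_eq_closed)
  then have "analytic S \<and> analytic (- S)"
  proof induction
    case (Basic T)
    then have T: "closed T" by simp
    have "analytic (- T)"
    \<comment> \<open>\<open>infdist\<close> to the empty set is 0 by convention, so the formula
      below fails for it.\<close>
    proof (cases "T = {}")
      case False
      have "- T = (\<Union>n. {x. inverse (real (Suc n)) \<le> infdist x T})"
      proof (intro equalityI subsetI)
        fix x assume "x \<in> - T"
        then have "infdist x T > 0"
          using T False in_closed_iff_infdist_zero[of T x] infdist_nonneg[of x T] by force
        then obtain n where "inverse (real (Suc n)) < infdist x T"
          using reals_Archimedean by blast
        then show "x \<in> (\<Union>n. {x. inverse (real (Suc n)) \<le> infdist x T})"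
          by (auto intro: less_imp_le)
      next
        fix x assume "x \<in> (\<Union>n. {x. inverse (real (Suc n)) \<le> infdist x T})"
        then obtain n where "inverse (real (Suc n)) \<le> infdist x T" by blast
        moreover have "0 < inverse (real (Suc n))" by simp
        ultimately show "x \<in> - T"
          using infdist_zero[of x T] by fastforce
      qed
      moreover have "closed {x. inverse (real (Suc n)) \<le> infdist x T}" for n
        by (intro closed_Collect_le continuous_intros)
      ultimately show ?thesis
        by (simp only:) (intro analytic_UN analytic_closed[OF U])
    qed (use U in simp)
    then show ?case
      using analytic_closed[OF U T] by simp
  next
    case Empty
    then show ?case using U by (simp add: analytic_empty)
  next
    case (Compl T)
    then show ?case by (simp add: Compl_eq_Diff_UNIV[symmetric])
  next
    case (Union T)
    then show ?case by (auto intro!: analytic_UN analytic_INT simp: Compl_UN)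
  qed
  then show ?thesis ..
qed

text \<open>Tychonoff's theorem; it supplies the limit of parameters in the next proof.\<close>

lemma compact_box: "compact {z :: nat \<Rightarrow> real. \<forall>i. \<bar>z i\<bar> \<le> b i}"
proof -
  have "compactin (product_topology (\<lambda>i. euclidean) UNIV) (PiE UNIV (\<lambda>i. {- b i..b i}))"
    unfolding compactin_PiE by simp
  moreover have "PiE UNIV (\<lambda>i. {- b i..b i}) = {z. \<forall>i. \<bar>z i\<bar> \<le> b i}"
  proof (rule set_eqI)
    fix z :: "nat \<Rightarrow> real"
    have "z i \<in> {- b i..b i} \<longleftrightarrow> \<bar>z i\<bar> \<le> b i" for i by auto
    then show "z \<in> PiE UNIV (\<lambda>i. {- b i..b i}) \<longleftrightarrow> z \<in> {z. \<forall>i. \<bar>z i\<bar> \<le> b i}"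
      by (simp only: PiE_UNIV_domain Pi_def mem_Collect_eq UNIV_I simp_thms)
  qed
  ultimately show ?thesis
    by (simp add: euclidean_product_topology)
qed

text \<open>Choquet's argument: the outer measure passes to increasing unions, so the coordinates of the
  parameter can be bounded one after the other at an arbitrarily small total cost, which makes the
  parameter set relatively compact.\<close>

lemma analytic_inner_approx:
  fixes M :: "'a::metric_space measure"
  assumes fin: "finite_measure M" and M: "sets M = sets borel" and "analytic S" and e: "0 < e"
  shows "\<exists>G\<in>sets borel. G \<subseteq> S \<and> outer_measure_of M S \<le> emeasure M G + ennreal e"
proof -
  interpret finite_measure M by (rule fin)
  obtain C :: "(nat \<Rightarrow> real) set" and f where C: "closed C" "continuous_on C f" "f ` C = S"
    using \<open>analytic S\<close> unfolding analytic_def by blast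
  have sp: "space M = UNIV" using sets_eq_imp_space_eq[OF M] by simp
  define I where "I T = outer_measure_of M (f ` T)" for T
  have I_fin: "I T < \<top>" for T
  proof -
    have "I T \<le> outer_measure_of M (space M)"
      unfolding I_def by (intro outer_measure_of_mono) (simp add: sp)
    also have "\<dots> < \<top>" by (simp add: less_top[symmetric])
    finally show ?thesis .
  qed
  have step: "\<exists>m. I T \<le> I (T \<inter> {z. \<bar>z j\<bar> \<le> real m}) + ennreal d" if "0 < d" for T j d
  proof -
    let ?T = "\<lambda>m. T \<inter> {z. \<bar>z j\<bar> \<le> real m}"
    have "(\<Union>m. f ` ?T m) = f ` T"
    proof -
      have "(\<Union>m. ?T m) = T"
        using real_arch_simple by auto
      then show ?thesis by (metis image_UN)
    qed
    moreover have "incseq (\<lambda>m. f ` ?T m)"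
      by (auto simp: incseq_def intro!: image_mono)
    ultimately have SUP: "(SUP m. I (?T m)) = I T"
      unfolding I_def using SUP_outer_measure_of_incseq[of "\<lambda>m. f ` ?T m" M] by (simp add: sp)
    show ?thesis
    proof (rule ccontr)
      assume neg: "\<nexists>m. I T \<le> I (?T m) + ennreal d"
      then have "I (?T m) + ennreal d \<le> I T" for m
        by (meson linear)
      then have "(SUP m. I (?T m) + ennreal d) \<le> I T"
        by (intro SUP_least)
      then have "I T + ennreal d \<le> I T"
        by (simp add: SUP[symmetric] ennreal_SUP_add_left)
      then show False
        using I_fin[of T] that by (cases "I T") (auto simp flip: ennreal_plus)
    qed
  qed
  \<comment> \<open>The costs of bounding the single coordinates add up to \<open>e\<close>.\<close>
  define d where "d j = e * (1/2) ^ Suc j" for j :: nat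
  have "0 < d j" for j using e by (simp add: d_def)
  define m where "m T j = (SOME m. I T \<le> I (T \<inter> {z. \<bar>z j\<bar> \<le> real m}) + ennreal (d j))" for T j
  have m: "I T \<le> I (T \<inter> {z. \<bar>z j\<bar> \<le> real (m T j)}) + ennreal (d j)" for T j
    unfolding m_def by (rule someI_ex[OF step[OF \<open>0 < d j\<close>]])
  define T where "T = rec_nat C (\<lambda>j T. T \<inter> {z. \<bar>z j\<bar> \<le> real (m T j)})"
  have T0: "T 0 = C" and TS: "T (Suc j) = T j \<inter> {z. \<bar>z j\<bar> \<le> real (m (T j) j)}" for j
    by (simp_all add: T_def)
  have T_dec: "decseq T" by (rule decseq_SucI) (auto simp: TS)
  have "I C \<le> I (T j) + ennreal (\<Sum>i<j. d i)" for j
  proof (induction j)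
    case (Suc j)
    note Suc
    also have "I (T j) + ennreal (\<Sum>i<j. d i) \<le> (I (T (Suc j)) + ennreal (d j)) + ennreal (\<Sum>i<j. d i)"
      unfolding TS by (intro add_right_mono m)
    also have "\<dots> = I (T (Suc j)) + ennreal (\<Sum>i<Suc j. d i)"
      using \<open>\<And>j. 0 < d j\<close> by (simp add: ennreal_plus sum_nonneg less_imp_le ac_simps)
    finally show ?case .
  qed (simp add: T0)
  moreover have "(\<Sum>i<j. d i) \<le> e" for j
  proof -
    have "d sums e" unfolding d_def using sums_mult[OF power_half_series, of e] by simp
    then show ?thesis
      using sum_le_suminf[of d "{..<j}"] \<open>\<And>j. 0 < d j\<close> by (auto simp: sums_iff less_imp_le)
  qed
  ultimately have I_ge: "I C \<le> I (T j) + ennreal e" for j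
    by (meson add_left_mono ennreal_leI order_trans)
  \<comment> \<open>The closures are measurable and decreasing, so continuity from above carries the
    lower bound over to \<open>G\<close>.\<close>
  define G where "G = (\<Inter>j. closure (f ` T j))"
  have G: "G \<in> sets borel" unfolding G_def by (intro borel_closed closed_INT) simp
  have "emeasure M G = (INF j. emeasure M (closure (f ` T j)))"
    unfolding G_def using T_dec
    by (intro INF_emeasure_decseq[symmetric]) (auto simp: M decseq_def intro!: closure_mono image_mono)
  also have "I C - ennreal e \<le> \<dots>"
  proof (rule INF_greatest)
    fix j
    have "I (T j) \<le> outer_measure_of M (closure (f ` T j))"
      unfolding I_def by (intro outer_measure_of_mono closure_subset)
    then have "I (T j) \<le> emeasure M (closure (f ` T j))"
      by (simp add: M)
    with I_ge[of j] have "I C \<le> ennreal e + emeasure M (closure (f ` T j))"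
      by (metis add.commute add_left_mono order_trans)
    then show "I C - ennreal e \<le> emeasure M (closure (f ` T j))"
      by (simp add: ennreal_minus_le_iff)
  qed
  finally have "outer_measure_of M S \<le> emeasure M G + ennreal e"
    by (simp add: ennreal_minus_le_iff I_def C(3) add.commute)
  \<comment> \<open>Parameters \<open>z j \<in> T j\<close> with images converging to
    \<open>y\<close> all lie in one compact box. A limit point of them belongs to the closed set
    \<open>C\<close>, and continuity of \<open>f\<close> there shows that its image is
    \<open>y\<close>.\<close>
  moreover have "G \<subseteq> S"
  proof
    fix y assume "y \<in> G"
    have "\<exists>z\<in>T j. dist (f z) y < inverse (real (Suc j))" for j
      using \<open>y \<in> G\<close> closure_approachable[of y "f ` T j"] by (auto simp: G_def)
    then obtain z where z: "\<And>j. z j \<in> T j" "\<And>j. dist (f (z j)) y < inverse (real (Suc j))"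
      by metis
    \<comment> \<open>Coordinate \<open>i\<close> is bounded by \<open>m (T i) i\<close> as soon as
      \<open>j > i\<close>; the maximum takes care of the finitely many earlier
      \<open>z j\<close>.\<close>
    define b where "b i = Max (insert (real (m (T i) i)) ((\<lambda>j. \<bar>z j i\<bar>) ` {..i}))" for i
    have bound: "\<bar>z j i\<bar> \<le> b i" for i j
    proof (cases "j \<le> i")
      case True
      then show ?thesis unfolding b_def by (intro Max_ge) auto
    next
      case False
      then have "z j \<in> T (Suc i)"
        using z(1)[of j] decseqD[OF T_dec, of "Suc i" j] by auto
      then have "\<bar>z j i\<bar> \<le> real (m (T i) i)" by (simp add: TS)
      also have "\<dots> \<le> b i" unfolding b_def by (intro Max_ge) auto
      finally show ?thesis .
    qed
    have "\<forall>j. z j \<in> {z. \<forall>i. \<bar>z i\<bar> \<le> b i}" by (simp add: bound)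
    from seq_compactE[OF compact_imp_seq_compact[OF compact_box] this]
    obtain x r where x: "strict_mono r" "(z \<circ> r) \<longlonglongrightarrow> x" by blast
    have zC: "z j \<in> C" for j
      using z(1)[of j] decseqD[OF T_dec, of 0 j] T0 by auto
    then have "x \<in> C"
      using closed_sequentially[OF C(1) _ x(2)] by simp
    have "(\<lambda>j. f (z (r j))) \<longlonglongrightarrow> f x"
      using C(2) x(2) \<open>x \<in> C\<close> zC by (auto simp: continuous_on_sequentially o_def)
    moreover have "(\<lambda>j. f (z j)) \<longlonglongrightarrow> y"
      by (rule metric_tendsto_imp_tendsto[OF LIMSEQ_inverse_real_of_nat])
        (use z(2) in \<open>auto intro!: eventuallyI less_imp_le simp: dist_real_def\<close>)
    then have "(\<lambda>j. f (z (r j))) \<longlonglongrightarrow> y"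
      using LIMSEQ_subseq_LIMSEQ[OF _ x(1)] by (auto simp: o_def)
    ultimately have "y = f x" by (rule LIMSEQ_unique[symmetric])
    with \<open>x \<in> C\<close> C(3) show "y \<in> S" by blast
  qed
  ultimately show ?thesis using G by blast
qed

section \<open>No covering below the Hausdorff dimension\<close>

text \<open>Inner regularity gives a compact \<open>K0 \<subseteq> E\<close> of positive measure.
  Removing the countably many basic open sets that are null in \<open>K0\<close> changes no measure
  and leaves the support.\<close>

lemma exists_closed_support:
  fixes Q :: "'a::polish_space measure"
  assumes "finite_measure Q" and Q: "sets Q = sets borel" and E: "E \<in> sets borel" "emeasure Q E \<noteq> 0"
  shows "\<exists>K. closed K \<and> K \<subseteq> E \<and> K \<noteq> {} \<and> (\<forall>W. open W \<longrightarrow> W \<inter> K \<noteq> {} \<longrightarrow> emeasure Q (W \<inter> K) \<noteq> 0)"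
proof -
  interpret finite_measure Q by fact
  have "0 < emeasure Q E" using E(2) by (simp add: zero_less_iff_neq_zero)
  also have "emeasure Q E = (SUP K \<in> {K. K \<subseteq> E \<and> compact K}. emeasure Q K)"
    using inner_regular[OF Q _ E(1)] by simp
  finally obtain K0 where K0: "K0 \<subseteq> E" "compact K0" "0 < emeasure Q K0"
    unfolding less_SUP_iff by blast
  obtain B :: "'a set set" where B: "countable B" "topological_basis B"
    using ex_countable_basis by blast
  define Z where "Z = \<Union>{W \<in> B. emeasure Q (W \<inter> K0) = 0}"
  have B_open: "open W" if "W \<in> B" for W
    using that B(2) by (rule topological_basis_open[rotated])
  have Z_open: "open Z" unfolding Z_def using B_open by blast
  have closed_K0: "closed K0" using K0(2) by (rule compact_imp_closed)
  have "(\<Union>W\<in>{W \<in> B. emeasure Q (W \<inter> K0) = 0}. W \<inter> K0) \<in> null_sets Q"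
    using B(1) B_open closed_K0 by (intro null_sets_UN') (auto simp: null_sets_def Q)
  moreover have "(\<Union>W\<in>{W \<in> B. emeasure Q (W \<inter> K0) = 0}. W \<inter> K0) = Z \<inter> K0"
    by (auto simp: Z_def)
  ultimately have null: "Z \<inter> K0 \<in> null_sets Q" by simp
  define K where "K = K0 - Z"
  have "closed K" unfolding K_def using closed_K0 Z_open by (rule closed_Diff)
  have em: "emeasure Q (T \<inter> K) = emeasure Q (T \<inter> K0)" if "T \<in> sets borel" for T
  proof -
    have "T \<inter> K = T \<inter> K0 - Z \<inter> K0" by (auto simp: K_def)
    also have "emeasure Q \<dots> = emeasure Q (T \<inter> K0)"
      using that closed_K0 null by (intro emeasure_Diff_null_set) (auto simp: Q)
    finally show ?thesis .
  qed
  have "K \<noteq> {}" using em[of UNIV] K0(3) by auto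
  moreover have "emeasure Q (W \<inter> K) \<noteq> 0" if W: "open W" "W \<inter> K \<noteq> {}" for W
  proof
    assume "emeasure Q (W \<inter> K) = 0"
    then have 0: "emeasure Q (W \<inter> K0) = 0" using em[of W] W(1) by simp
    obtain y where y: "y \<in> W" "y \<in> K" using W(2) by blast
    obtain V where V: "V \<in> B" "y \<in> V" "V \<subseteq> W"
      using topological_basisE[OF B(2) W(1) y(1)] by blast
    have "emeasure Q (V \<inter> K0) \<le> emeasure Q (W \<inter> K0)"
      using V(3) W(1) closed_K0 by (intro emeasure_mono) (auto simp: Q)
    with 0 V y(2) show False by (auto simp: K_def Z_def)
  qed
  ultimately show ?thesis
    using \<open>closed K\<close> K0(1) by (intro exI[of _ K]) (auto simp: K_def)
qed

lemma mem_uniform_covering_set_iff: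
  "x \<in> uniform_covering_set l w \<longleftrightarrow> (\<exists>N\<in>{1..}. \<forall>n\<in>{N..}. \<exists>k\<in>{1..n}. dist (w k) x < l n / 2)"
  by (simp add: uniform_covering_set_def covered_upto_def)

lemma uniform_covering_set_cong:
  assumes "\<And>k. k \<ge> 1 \<Longrightarrow> w k = w' k"
  shows "uniform_covering_set l w = uniform_covering_set l w'"
proof -
  have "covered_upto l w n = covered_upto l w' n" for n
    unfolding covered_upto_def using assms by (intro SUP_cong) auto
  then show ?thesis by (simp add: uniform_covering_set_def)
qed

text \<open>Otherwise the sequences in \<open>K\<close> that leave \<open>x\<close> uncovered at some time after \<open>N\<close> would form a dense open
  subset of \<open>K\<close> for every \<open>N\<close>, contradicting the Baire category theorem.\<close>

lemma uniformly_covered_on_open: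
  fixes K :: "(nat \<Rightarrow> circle) set"
  assumes K: "closed K" "K \<noteq> {}" and B: "topological_basis B"
    and cov: "\<And>w. w \<in> K \<Longrightarrow> x \<in> uniform_covering_set l w"
  shows "\<exists>W\<in>B. \<exists>N. W \<inter> K \<noteq> {} \<and> (\<forall>w\<in>W \<inter> K. \<forall>n\<ge>N. \<exists>k\<in>{1..n}. dist x (w k) \<le> l n / 2)"
  (is ?thesis')
proof (rule ccontr)
  assume neg: "\<not> ?thesis'"
  \<comment> \<open>The strict inequality makes \<open>V N\<close> open. Its negation is the reason
    for the closed arcs in the conclusion.\<close>
  define V where "V N = (\<Union>n\<in>{N..}. \<Inter>k\<in>{1..n}. {w :: nat \<Rightarrow> circle. l n / 2 < dist x (w k)})" for N
  have V_open: "open (V N)" for N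
    unfolding V_def
    by (intro open_UN ballI open_INT finite_atLeastAtMost open_Collect_less continuous_on_dist
        continuous_on_const continuous_on_product_coordinates)
  have "(top_of_set K) closure_of \<Inter>(range (\<lambda>N. K \<inter> V N)) = topspace (top_of_set K)"
  proof (rule Baire_category)
    show "completely_metrizable_space (top_of_set K) \<or> locally_compact_space (top_of_set K) \<and> regular_space (top_of_set K)"
      using completely_metrizable_space_closedin[OF completely_metrizable_space_euclidean
          K(1)[unfolded closed_closedin]] by blast
    fix T assume "T \<in> range (\<lambda>N. K \<inter> V N)"
    then obtain N where T: "T = K \<inter> V N" by blast
    \<comment> \<open>Density: the negated claim provides a sequence of \<open>V N\<close> in every
      basic open set that meets \<open>K\<close>.\<close>
    have "y \<in> (top_of_set K) closure_of T" if y: "y \<in> K" for y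
      unfolding in_closure_of
    proof (intro conjI allI impI)
      fix S assume S: "y \<in> S \<and> openin (top_of_set K) S"
      then obtain S' where S': "open S'" "S = K \<inter> S'"
        by (auto simp: openin_open)
      have "y \<in> S'" using S S'(2) by blast
      then obtain W where W: "W \<in> B" "y \<in> W" "W \<subseteq> S'"
        by (rule topological_basisE[OF B S'(1)])
      have "W \<inter> K \<noteq> {}" using W(2) y by blast
      have "\<not> (\<forall>w\<in>W \<inter> K. \<forall>n\<ge>N. \<exists>k\<in>{1..n}. dist x (w k) \<le> l n / 2)"
      proof
        assume "\<forall>w\<in>W \<inter> K. \<forall>n\<ge>N. \<exists>k\<in>{1..n}. dist x (w k) \<le> l n / 2"
        with W(1) \<open>W \<inter> K \<noteq> {}\<close> have ?thesis'
          by (intro bexI[of _ W] exI[of _ N] conjI)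
        with neg show False by (rule notE)
      qed
      then obtain w n where w: "w \<in> W \<inter> K" "n \<ge> N" "\<And>k. k \<in> {1..n} \<Longrightarrow> \<not> dist x (w k) \<le> l n / 2"
        by blast
      then have "w \<in> V N"
        unfolding V_def by (auto simp: not_le intro!: bexI[of _ n])
      then show "\<exists>w. w \<in> T \<and> w \<in> S"
        using w(1) W(3) S'(2) T by blast
    qed (use y in simp)
    then show "openin (top_of_set K) T \<and> (top_of_set K) closure_of T = topspace (top_of_set K)"
      using V_open[of N] closure_of_subset_topspace[of "top_of_set K" T]
      by (auto simp: T openin_open_Int)
  qed simp
  then have "\<Inter>(range (\<lambda>N. K \<inter> V N)) \<noteq> {}"
    using K(2) by (metis closure_of_empty topspace_euclidean_subtopology)
  then obtain w where w: "w \<in> K" "\<And>N. w \<in> V N" by blast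
  obtain N where N: "\<And>n. n \<ge> N \<Longrightarrow> \<exists>k\<in>{1..n}. dist (w k) x < l n / 2"
    using cov[OF w(1)] unfolding mem_uniform_covering_set_iff by auto
  obtain n where "n \<ge> N" "\<And>k. k \<in> {1..n} \<Longrightarrow> l n / 2 < dist x (w k)"
    using w(2)[of N] unfolding V_def by blast
  with N[of n] show False
    by (metis dist_commute not_less_iff_gr_or_eq)
qed

section \<open>The law of the random sequence\<close>

context iid_uniform
begin

text \<open>As a map into the full space \<open>nat \<Rightarrow> circle\<close> it has a Borel law
  on a Polish space, while its values still belong to the product over \<open>{1..}\<close>.\<close>

definition trajectory :: "'a \<Rightarrow> nat \<Rightarrow> circle" where
  "trajectory x = (\<lambda>k\<in>{1..}. X k x)"

lemma measurable_trajectory [measurable]: "trajectory \<in> borel_measurable M"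
proof (rule measurable_coordinatewise_then_product)
  fix k show "(\<lambda>x. trajectory x k) \<in> borel_measurable M"
    using measurable_X[of k] by (cases "k \<ge> 1") (simp_all add: trajectory_def)
qed

lemma uniform_covering_set_trajectory: "uniform_covering_set l (trajectory x) = uniform_covering_set l (\<lambda>k. X k x)"
  by (rule uniform_covering_set_cong) (simp add: trajectory_def)

lemma emeasure_trajectory_covering_eq_0:
  assumes c: "0 < c" "c < s" and l: "\<And>n. n \<ge> 1 \<Longrightarrow> l n = c * (ln (real n) / real n)"
    and A: "hausdorff_measure s A \<noteq> 0"
    and E: "E \<in> sets borel" "\<And>w. w \<in> E \<Longrightarrow> A \<subseteq> uniform_covering_set l w"
  shows "emeasure (distr M borel trajectory) E = 0"
proof (rule ccontr)
  assume pos: "emeasure (distr M borel trajectory) E \<noteq> 0"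
  interpret Q: prob_space "distr M borel trajectory" by (rule prob_space_distr) simp
  obtain K where K: "closed K" "K \<subseteq> E" "K \<noteq> {}"
    "\<And>W. open W \<Longrightarrow> W \<inter> K \<noteq> {} \<Longrightarrow> emeasure (distr M borel trajectory) (W \<inter> K) \<noteq> 0"
    using exists_closed_support[OF Q.finite_measure_axioms _ E(1) pos] by auto
  obtain B :: "(nat \<Rightarrow> circle) set set" where B: "countable B" "topological_basis B"
    using ex_countable_basis by blast
  define P where "P W N = {x \<in> A. \<forall>w\<in>W \<inter> K. \<forall>n\<ge>N. \<exists>k\<in>{1..n}. dist x (w k) \<le> l n / 2}" for W N
  \<comment> \<open>Otherwise the second moment estimate would make \<open>W \<inter> K\<close> a
    null set, which is impossible in the support.\<close>
  have null: "hausdorff_measure s (P W N) = 0" if W: "W \<in> B" "W \<inter> K \<noteq> {}" for W N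
  proof (rule ccontr)
    assume P: "hausdorff_measure s (P W N) \<noteq> 0"
    have "open W" using B(2) W(1) by (rule topological_basis_open)
    then have meas: "W \<inter> K \<in> sets borel" using K(1) by auto
    have "prob (trajectory -` (W \<inter> K) \<inter> space M) = 0"
    proof (rule prob_closed_covered_eq_0[OF c l P])
      show "trajectory -` (W \<inter> K) \<inter> space M \<in> events"
        using measurable_sets[OF measurable_trajectory meas] .
      fix x y n assume "x \<in> trajectory -` (W \<inter> K) \<inter> space M" "y \<in> P W N" "n \<ge> N"
      then have "\<exists>k\<in>{1..n}. dist y (trajectory x k) \<le> l n / 2"
        unfolding P_def by blast
      then show "\<exists>k\<in>{1..n}. dist y (X k x) \<le> l n / 2"
        by (auto simp: trajectory_def)
    qed
    then have "emeasure (distr M borel trajectory) (W \<inter> K) = 0"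
      using meas by (simp add: emeasure_distr emeasure_eq_measure)
    with K(4)[OF \<open>open W\<close> W(2)] show False by simp
  qed
  define I where "I = {W \<in> B. W \<inter> K \<noteq> {}} \<times> (UNIV :: nat set)"
  have cover: "\<exists>(W, N)\<in>I. x \<in> P W N" if "x \<in> A" for x
    using uniformly_covered_on_open[OF K(1,3) B(2), of x l] that E(2) K(2)
    by (fastforce simp: I_def P_def)
  \<comment> \<open>This makes \<open>I\<close> nonempty, so that \<open>from_nat_into\<close>
    enumerates it.\<close>
  have "A \<noteq> {}"
  proof
    assume "A = {}"
    then have "hausdorff_premeasure s \<delta> A \<le> (\<Sum>i. diam_power s ({} :: circle set))" if "\<delta> > 0" for \<delta>
      using that by (intro hausdorff_premeasure_le) auto
    then show False
      using A by (simp add: hausdorff_measure_def diam_power_def)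
  qed
  then have "I \<noteq> {}" using cover by blast
  moreover have "countable I" unfolding I_def using B(1) by auto
  ultimately have I: "range (from_nat_into I) = I" by (rule range_from_nat_into)
  have "hausdorff_measure s (\<Union>i. case_prod P (from_nat_into I i)) = 0"
  proof (rule hausdorff_measure_UN_eq_0)
    fix i
    obtain W N where WN: "from_nat_into I i = (W, N)" by fastforce
    then have "(W, N) \<in> I" using I by (metis rangeI)
    then show "hausdorff_measure s (case_prod P (from_nat_into I i)) = 0"
      unfolding WN using null by (auto simp: I_def)
  qed
  moreover have "A \<subseteq> (\<Union>i. case_prod P (from_nat_into I i))"
  proof
    fix x assume "x \<in> A"
    then obtain W N where WN: "(W, N) \<in> I" "x \<in> P W N" using cover by blast
    then obtain i where "from_nat_into I i = (W, N)" using I by (metis imageE)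
    with WN(2) have "x \<in> case_prod P (from_nat_into I i)" by simp
    then show "x \<in> (\<Union>i. case_prod P (from_nat_into I i))"
      by (rule UN_I[OF UNIV_I])
  qed
  then have "hausdorff_measure s A \<le> hausdorff_measure s (\<Union>i. case_prod P (from_nat_into I i))"
    by (rule hausdorff_measure_mono)
  ultimately show False using A by simp
qed

end

text \<open>Coordinate 0 lifts the point of the circle, the remaining coordinates lift the
  sequence.\<close>

lemma analytic_UNIV_circle_sequence: "analytic (UNIV :: (circle \<times> (nat \<Rightarrow> circle)) set)"
proof -
  let ?f = "\<lambda>z :: nat \<Rightarrow> real. (to_circle (z 0), \<lambda>k. to_circle (z (Suc k)))"
  have "continuous_on UNIV (\<lambda>z :: nat \<Rightarrow> real. to_circle (z k))" for k
    by (rule continuous_on_compose2[OF continuous_on_to_circle[of UNIV] continuous_on_product_coordinates]) simp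
  then have "continuous_on UNIV ?f"
    by (intro continuous_on_Pair continuous_on_coordinatewise_then_product)
  moreover have "?f ` UNIV = UNIV"
  proof (intro UNIV_eq_I[symmetric])
    fix p :: "circle \<times> (nat \<Rightarrow> circle)"
    obtain a where a: "fst p = to_circle a" by (rule to_circle_surj)
    have "\<forall>k. \<exists>b. snd p k = to_circle b" by (metis to_circle_surj)
    then obtain b where b: "\<And>k. snd p k = to_circle (b k)" by metis
    have "p = ?f (case_nat a b)"
      by (simp add: prod_eq_iff a b fun_eq_iff)
    then show "p \<in> range ?f" by blast
  qed
  ultimately show ?thesis
    unfolding analytic_def by (intro exI[of _ UNIV] exI[of _ ?f]) auto
qed

text \<open>The set is the projection of the Borel set of pairs of a point of \<open>A\<close> and a
  sequence that does not cover it; the projection replaces an uncountable union over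
  \<open>A\<close>.\<close>

lemma analytic_not_covering:
  assumes "A \<in> sets borel"
  shows "analytic {w. \<not> A \<subseteq> uniform_covering_set l w}"
proof -
  define D where "D = {p :: circle \<times> (nat \<Rightarrow> circle). fst p \<in> A \<and> fst p \<notin> uniform_covering_set l (snd p)}"
  have "open {p :: circle \<times> (nat \<Rightarrow> circle). dist (snd p k) (fst p) < r}" for k r
    by (intro open_Collect_less continuous_intros
        continuous_on_compose2[OF continuous_on_product_coordinates continuous_on_snd]) auto
  then have [measurable]: "Measurable.pred borel (\<lambda>p :: circle \<times> (nat \<Rightarrow> circle). dist (snd p k) (fst p) < r)" for k r
    by (simp add: pred_def)
  have "fst \<in> borel_measurable (borel :: (circle \<times> (nat \<Rightarrow> circle)) measure)"
    by (intro borel_measurable_continuous_onI continuous_on_fst continuous_on_id)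
  from measurable_sets[OF this assms]
  have [measurable]: "Measurable.pred borel (\<lambda>p :: circle \<times> (nat \<Rightarrow> circle). fst p \<in> A)"
    by (simp add: pred_def vimage_def)
  have "D \<in> sets borel"
    unfolding D_def mem_uniform_covering_set_iff by measurable
  then have "analytic D"
    by (rule analytic_borel[OF analytic_UNIV_circle_sequence])
  then have "analytic (snd ` D)"
    by (rule analytic_image) (intro continuous_on_snd continuous_on_id)
  moreover have "snd ` D = {w. \<not> A \<subseteq> uniform_covering_set l w}"
  proof (intro equalityI subsetI)
    fix w assume "w \<in> {w. \<not> A \<subseteq> uniform_covering_set l w}"
    then obtain x where "(x, w) \<in> D" by (auto simp: D_def)
    then show "w \<in> snd ` D" by force
  qed (auto simp: D_def)
  ultimately show ?thesis by simp
qed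

text \<open>A measurable hull of the set \<open>S\<close> of non-covering sequences has a complement
  of covering sequences, hence a null one, so \<open>S\<close> has outer measure 1. As
  \<open>S\<close> is analytic, Borel subsets of it have measure arbitrarily close to 1, and their
  union has measure 1.\<close>

lemma (in iid_uniform) AE_not_uniform_covering:
  assumes c: "0 < c" "c < s" and l: "\<And>n. n \<ge> 1 \<Longrightarrow> l n = c * (ln (real n) / real n)"
    and A: "hausdorff_measure s A \<noteq> 0" "A \<in> sets borel"
  shows "AE x in M. \<not> A \<subseteq> uniform_covering_set l (\<lambda>k. X k x)"
proof -
  define Q where "Q = distr M borel trajectory"
  interpret Q: prob_space Q unfolding Q_def by (rule prob_space_distr) simp
  have Q [simp]: "sets Q = sets borel" "space Q = UNIV" by (simp_all add: Q_def)
  define S where "S = {w. \<not> A \<subseteq> uniform_covering_set l w}"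
  obtain E where E: "E \<in> sets Q" "S \<subseteq> E" "outer_measure_of Q S = emeasure Q E"
    using outer_measure_of_attain[of S Q] by auto
  have "emeasure Q (- E) = 0"
    unfolding Q_def using E(1,2)
    by (intro emeasure_trajectory_covering_eq_0[OF c l A(1)]) (auto simp: S_def)
  then have "Q.prob (- E) = 0" by (simp add: measure_def)
  then have "Q.prob E = 1"
    using Q.prob_compl[OF E(1)] by (simp add: Compl_eq_Diff_UNIV)
  then have S1: "outer_measure_of Q S = 1"
    by (simp add: E(3) Q.emeasure_eq_measure)
  have "\<exists>G\<in>sets borel. G \<subseteq> S \<and> 1 \<le> emeasure Q G + ennreal (inverse (real (Suc n)))" for n
    using analytic_inner_approx[OF Q.finite_measure_axioms Q(1) analytic_not_covering[OF A(2)], of "inverse (real (Suc n))" l]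
    unfolding S_def[symmetric] S1 by simp
  then obtain G where G: "\<And>n. G n \<in> sets borel" "\<And>n. G n \<subseteq> S"
    "\<And>n. 1 \<le> emeasure Q (G n) + ennreal (inverse (real (Suc n)))"
    by metis
  have "1 \<le> Q.prob (\<Union>n. G n)"
  proof (rule field_le_epsilon)
    fix e :: real assume "0 < e"
    then obtain n where n: "inverse (real (Suc n)) < e" using reals_Archimedean by blast
    have "1 \<le> Q.prob (G n) + inverse (real (Suc n))"
      using G(3)[of n] by (simp add: Q.emeasure_eq_measure del: of_nat_Suc flip: ennreal_plus ennreal_1)
    moreover have "Q.prob (G n) \<le> Q.prob (\<Union>n. G n)"
      using G(1) by (intro Q.finite_measure_mono) auto
    ultimately show "1 \<le> Q.prob (\<Union>n. G n) + e" using n by linarith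
  qed
  then have "Q.prob (\<Union>n. G n) = 1"
    using Q.prob_le_1[of "\<Union>n. G n"] by linarith
  then have "AE w in Q. w \<in> (\<Union>n. G n)"
    by (rule Q.AE_prob_1)
  then have "AE w in Q. w \<in> S"
    by eventually_elim (use G(2) in blast)
  then have "AE x in M. trajectory x \<in> S"
    unfolding Q_def by (rule AE_distrD[OF measurable_trajectory])
  then show ?thesis
    by (simp add: S_def uniform_covering_set_trajectory)
qed

text \<open>Measurability of the covering event is part of the claim above the box dimension, and
  below the Hausdorff dimension for Borel \<open>A\<close>. For arbitrary \<open>A\<close> the last
  clause says that the inner probability is 0: every measurable set of covering sequences is
  null.\<close>

theorem corollary1:
  fixes M :: "'w measure" and \<omega> :: "nat \<Rightarrow> 'w \<Rightarrow> circle"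
    and c :: real and l :: "nat \<Rightarrow> real" and A :: "circle set"
  assumes "prob_space M"
    and "prob_space.indep_vars M (\<lambda>_. borel) \<omega> {1..}"
    and "\<And>k. k \<ge> 1 \<Longrightarrow> distr M borel (\<omega> k) = uniform_circle"
    and "c > 0"
    and "\<And>n. n \<ge> 1 \<Longrightarrow> l n = c * (ln (real n) / real n)"
  defines "covers \<equiv> {x \<in> space M. A \<subseteq> uniform_covering_set l (\<lambda>k. \<omega> k x)}"
  shows "(ereal c > upper_box_dim A + 1 \<longrightarrow>
            covers \<in> sets (completion M) \<and> measure (completion M) covers = 1) \<and>
         (ereal c < hausdorff_dim A \<longrightarrow>
            (A \<in> sets borel \<longrightarrow>
               covers \<in> sets (completion M) \<and> measure (completion M) covers = 0) \<and>
            (\<forall>E \<in> sets (PiM {1..} (\<lambda>_. borel)).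
               (\<forall>w\<in>E. A \<subseteq> uniform_covering_set l w) \<longrightarrow>
               measure M {x \<in> space M. (\<lambda>k\<in>{1..}. \<omega> k x) \<in> E} = 0))"
proof (intro conjI impI)
  interpret prob_space M by fact
  interpret iid_uniform M \<omega>
    using assms(2,3) by unfold_locales auto
  interpret C: prob_space "completion M" by (rule prob_space_completion)
  {
    assume "ereal c > upper_box_dim A + 1"
    then have AE: "AE x in M. A \<subseteq> uniform_covering_set l (\<lambda>k. \<omega> k x)"
      using assms(4,5) by (intro AE_uniform_covering[where c = c]) auto
    \<comment> \<open>\<open>sets_completion_AE\<close> speaks of predicates that fail almost
      everywhere, so the complement comes first.\<close>
    then have "Measurable.pred (completion M) (\<lambda>x. \<not> A \<subseteq> uniform_covering_set l (\<lambda>k. \<omega> k x))"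
      by (intro sets_completion_AE) simp
    then have "Measurable.pred (completion M) (\<lambda>x. \<not> \<not> A \<subseteq> uniform_covering_set l (\<lambda>k. \<omega> k x))"
      by (rule pred_intros_logic)
    then show sets: "covers \<in> sets (completion M)"
      by (simp add: covers_def pred_def)
    show "measure (completion M) covers = 1"
      unfolding C.prob_eq_1[OF sets] using AE_completion[OF AE] AE_space[of "completion M"]
      by eventually_elim (simp add: covers_def)
  }
  assume "ereal c < hausdorff_dim A"
  then have "\<not> hausdorff_dim A \<le> ereal c" by simp
  then obtain s where s: "c < s" "hausdorff_measure s A \<noteq> 0"
    using hausdorff_dim_le[of c A] assms(4) by force
  {
    assume "A \<in> sets borel"
    then have AE: "AE x in M. \<not> A \<subseteq> uniform_covering_set l (\<lambda>k. \<omega> k x)"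
      using assms(4,5) s by (intro AE_not_uniform_covering[where c = c and s = s]) auto
    then show sets: "covers \<in> sets (completion M)"
      using sets_completion_AE[OF AE] by (simp add: covers_def pred_def)
    show "measure (completion M) covers = 0"
      unfolding C.prob_eq_0[OF sets] using AE_completion[OF AE]
      by eventually_elim (simp add: covers_def)
  }
  show "\<forall>E \<in> sets (PiM {1..} (\<lambda>_. borel)). (\<forall>w\<in>E. A \<subseteq> uniform_covering_set l w) \<longrightarrow>
          measure M {x \<in> space M. (\<lambda>k\<in>{1..}. \<omega> k x) \<in> E} = 0"
  proof (intro ballI impI)
    fix E assume E: "E \<in> sets (PiM {1..} (\<lambda>_. borel))" "\<forall>w\<in>E. A \<subseteq> uniform_covering_set l w"
    \<comment> \<open>Pulling \<open>E\<close> back along the restriction to \<open>{1..}\<close>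
      moves it into the full sequence space. Its preimage under \<open>trajectory\<close> is the
      given event, since trajectories are already restricted.\<close>
    define E' where "E' = {w :: nat \<Rightarrow> circle. restrict w {1..} \<in> E}"
    have "(\<lambda>w. restrict w {1..}) \<in> measurable borel (PiM {1..} (\<lambda>_. borel :: circle measure))"
      by (intro measurable_restrict borel_measurable_continuous_onI continuous_on_product_coordinates)
    from measurable_sets[OF this E(1)] have E': "E' \<in> sets borel"
      by (simp add: E'_def vimage_def)
    have "A \<subseteq> uniform_covering_set l w" if "w \<in> E'" for w
      using that E(2) uniform_covering_set_cong[of w "restrict w {1..}" l] by (auto simp: E'_def)
    then have "emeasure (distr M borel trajectory) E' = 0"
      using assms(4,5) s E' by (intro emeasure_trajectory_covering_eq_0[where c = c and s = s and l = l and A = A]) auto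
    then have "emeasure M (trajectory -` E' \<inter> space M) = 0"
      using E' by (simp add: emeasure_distr)
    moreover have "trajectory -` E' \<inter> space M = {x \<in> space M. (\<lambda>k\<in>{1..}. \<omega> k x) \<in> E}"
      by (auto simp: E'_def trajectory_def)
    ultimately show "measure M {x \<in> space M. (\<lambda>k\<in>{1..}. \<omega> k x) \<in> E} = 0"
      by (simp add: measure_def)
  qed
qed

end
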